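(* Let $A$ be a free Perm algebra, i.e. $A\cong\mathrm{Perm}\langle X\rangle$ for some set $X$, let $(P,\cdot_P)$ be a pre-Lie algebra, and let $N$ be a $P$-bimodule. Then the cochain map $$\Psi: C^*_{\mathrm{Pre}}(P,N)\to C^*_{\mathrm{Lie}}(A\otimes P,A\otimes N)$$ defined in the context is injective.
   Context: All algebras are over a field $\Bbbk$; $\otimes=\otimes_\Bbbk$; a hat denotes omission. Perm algebra: an algebra with $(ab)c=a(bc)=a(cb)$ for all $a,b,c$. Free Perm algebra on a set $X=\{x_1,x_2,\dots\}$: let $F\langle X\rangle$ be the free non-unital associative algebra on $X$ and $I$ the two-sided ideal generated by all $x(yz)-x(zy)$, $x,y,z\in F\langle X\rangle$; then $\mathrm{Perm}\langle X\rangle:=F\langle X\rangle/I$. Pre-Lie (right-symmetric) algebra: a vector space $P$ with a bilinear operation $\cdot_P$ such that $(a\cdot_P b)\cdot_P c-a\cdot_P(b\cdot_P c)=(a\cdot_P c)\cdot_P b-a\cdot_P(c\cdot_P b)$ for all $a,b,c\in P$. Its Lie bracket is $[a,b]=a\cdot_P b-b\cdot_P a$. $P$-bimodule: a vector space $N$ with bilinear left and right actions of $P$ such that for $a,b\in P$, $m\in N$: $(a\cdot b)\cdot m-a\cdot(b\cdot m)=(a\cdot m)\cdot b-a\cdot(m\cdot b)$ and $(m\cdot a)\cdot b-m\cdot(a\cdot b)=(m\cdot b)\cdot a-m\cdot(b\cdot a)$. $A\otimes P$ is the Lie algebra with bracket $[a_1\otimes p_1,a_2\otimes p_2]=a_1a_2\otimes(p_1\cdot_P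 p_2)-a_2a_1\otimes(p_2\cdot_P p_1)$. $A\otimes N$ is the $A\otimes P$-module with action $(a'\otimes p)\cdot(a\otimes n)=a'a\otimes(p\cdot n)-aa'\otimes(n\cdot p)$. Pre-Lie cochain complex: for $k\ge1$, $C^k_{\mathrm{Pre}}(P,N)$ consists of multilinear maps $\psi:P^{\otimes k}\to N$, with coboundary operator $$\begin{aligned}(\delta_{\mathrm{Pre}}\psi)(a_0,a_1,\dots,a_k)=&-\sum_{i=1}^k(-1)^i a_0\cdot\psi(a_i,a_1,\dots,\widehat{a_i},\dots,a_k)+\sum_{i=1}^k(-1)^i\psi(a_0\cdot_P a_i,a_1,\dots,\widehat{a_i},\dots,a_k)\\&+\sum_{1\le i<j\le k}(-1)^{i+1}\psi(a_0,a_1,\dots,\widehat{a_i},\dots,[a_i,a_j],\dots,a_k)-\sum_{i=1}^k(-1)^i\psi(a_0,a_1,\dots,\widehat{a_i},\dots,a_k)\cdot a_i,\end{aligned}$$ where in the third sum $[a_i,a_j]$ stands in the place of $a_j$. $C^*_{\mathrm{Lie}}(\mathfrak g,M)$ is the usual Chevalley–Eilenberg complex of alternating multilinear maps from a Lie algebra $\mathfrak g$ to a $\mathfrak g$-module $M$. The map $\Psi$: for $f\in C^n_{\mathrm{Pre}}(P,N)$, $a_1,\dots,a_n\in A$ and $b_1,\dots,b_n\in P$, $$\begin{aligned}\Psi(f)(a_1\otimes b_1,\dots,a_n\otimes b_n)=\ & a_1a_2\cdots a_n\otimes f(b_1,b_2,\dots,b_n)-a_2a_1a_3\cdots a_n\otimes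 f(b_2,b_1,b_3,\dots,b_n)\\&+\sum_{i=2}^{n-2}(-1)^i a_{i+1}a_i\cdots a_1a_{i+2}\cdots a_n\otimes f(b_1,\dots,b_{i-1},b_{i+1},b_i,b_{i+2},\dots,b_n)\\&+(-1)^{n-1}a_na_{n-1}\cdots a_1\otimes f(b_n,b_{n-1},\dots,b_2,b_1),\end{aligned}$$ where coinciding terms are not repeated for small $n$: for $n=1$, $\Psi(f)(a_1\otimes b_1)=a_1\otimes f(b_1)$, and for $n=2$, $\Psi(f)(a_1\otimes b_1,a_2\otimes b_2)=a_1a_2\otimes f(b_1,b_2)-a_2a_1\otimes f(b_2,b_1)$.
   Formalization: X is assumed to have at least two elements (for |X|≤1, Ψ kills nonzero symmetric f in degree 2), and Ψ is taken into all multilinear maps rather than C_Lie, since by the displayed formula Ψ(f) need not be alternating for n≥3; being a cochain map is not claimed. *)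

theory Defs
  imports "HOL-Algebra.QuotRing" "HOL-Algebra.Module"
begin

text \<open>
  A vector space over a field \<open>K\<close> is a module \<open>V\<close> with \<open>module K V\<close>. Records of type
  \<open>('k, 'v) module\<close> carry a multiplication that the locale \<open>module\<close> does not constrain; for the
  (nonassociative, not necessarily unital) algebras below this field is the product. The field
  \<open>one\<close> is never used.
\<close>

definition bilinear_map ::
  "('k, 'e) ring_scheme \<Rightarrow> ('k, 'u) module \<Rightarrow> ('k, 'v) module \<Rightarrow> ('k, 'w) module
    \<Rightarrow> ('u \<Rightarrow> 'v \<Rightarrow> 'w) \<Rightarrow> bool" where
  "bilinear_map K U V W f \<longleftrightarrow>
    (\<forall>u \<in> carrier U. \<forall>v \<in> carrier V. f u v \<in> carrier W) \<and>
    (\<forall>u \<in> carrier U. \<forall>u' \<in> carrier U. \<forall>v \<in> carrier V.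
      f (u \<oplus>\<^bsub>U\<^esub> u') v = f u v \<oplus>\<^bsub>W\<^esub> f u' v) \<and>
    (\<forall>u \<in> carrier U. \<forall>v \<in> carrier V. \<forall>v' \<in> carrier V.
      f u (v \<oplus>\<^bsub>V\<^esub> v') = f u v \<oplus>\<^bsub>W\<^esub> f u v') \<and>
    (\<forall>c \<in> carrier K. \<forall>u \<in> carrier U. \<forall>v \<in> carrier V.
      f (c \<odot>\<^bsub>U\<^esub> u) v = c \<odot>\<^bsub>W\<^esub> f u v \<and> f u (c \<odot>\<^bsub>V\<^esub> v) = c \<odot>\<^bsub>W\<^esub> f u v)"

definition nonassoc_algebra :: "('k, 'e) ring_scheme \<Rightarrow> ('k, 'a) module \<Rightarrow> bool" where
  "nonassoc_algebra K A \<longleftrightarrow> module K A \<and> bilinear_map K A A A (mult A)"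

definition algebra_iso ::
  "('k, 'e) ring_scheme \<Rightarrow> ('k, 'a) module \<Rightarrow> ('k, 'b) module \<Rightarrow> ('a \<Rightarrow> 'b) \<Rightarrow> bool" where
  "algebra_iso K A B \<phi> \<longleftrightarrow>
    bij_betw \<phi> (carrier A) (carrier B) \<and>
    (\<forall>x \<in> carrier A. \<forall>y \<in> carrier A. \<phi> (x \<oplus>\<^bsub>A\<^esub> y) = \<phi> x \<oplus>\<^bsub>B\<^esub> \<phi> y) \<and>
    (\<forall>c \<in> carrier K. \<forall>x \<in> carrier A. \<phi> (c \<odot>\<^bsub>A\<^esub> x) = c \<odot>\<^bsub>B\<^esub> \<phi> x) \<and>
    (\<forall>x \<in> carrier A. \<forall>y \<in> carrier A. \<phi> (x \<otimes>\<^bsub>A\<^esub> y) = \<phi> x \<otimes>\<^bsub>B\<^esub> \<phi> y)"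

text \<open>The product on a quotient is meaningful only when \<open>H\<close> is a two-sided ideal.\<close>

definition quotient_module ::
  "('k, 'v) module \<Rightarrow> 'v set \<Rightarrow> ('k, 'v set) module" where
  "quotient_module V H =
    \<lparr>carrier = a_rcosets\<^bsub>V\<^esub> H, mult = rcoset_mult V H, one = H +>\<^bsub>V\<^esub> \<one>\<^bsub>V\<^esub>,
     zero = H, add = set_add V,
     smult = (\<lambda>c C. \<Union>v \<in> C. H +>\<^bsub>V\<^esub> (c \<odot>\<^bsub>V\<^esub> v))\<rparr>"

text \<open>The free vector space on \<open>S\<close>: finitely supported functions on \<open>S\<close>, extended by zero.\<close>

definition free_module ::
  "('k, 'e) ring_scheme \<Rightarrow> 's set \<Rightarrow> ('k, 's \<Rightarrow> 'k) module" where
  "free_module K S =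
    \<lparr>carrier = {f. (\<forall>s. f s \<in> carrier K) \<and> (\<forall>s. s \<notin> S \<longrightarrow> f s = \<zero>\<^bsub>K\<^esub>) \<and>
                    finite {s. f s \<noteq> \<zero>\<^bsub>K\<^esub>}},
     mult = undefined, one = undefined,
     zero = (\<lambda>s. \<zero>\<^bsub>K\<^esub>), add = (\<lambda>f g s. f s \<oplus>\<^bsub>K\<^esub> g s),
     smult = (\<lambda>c f s. c \<otimes>\<^bsub>K\<^esub> f s)\<rparr>"

definition delta :: "('k, 'e) ring_scheme \<Rightarrow> 's \<Rightarrow> 's \<Rightarrow> 'k" where
  "delta K s = (\<lambda>t. if t = s then \<one>\<^bsub>K\<^esub> else \<zero>\<^bsub>K\<^esub>)"


subsection \<open>Free Perm algebras\<close>

text \<open>The free non-unital associative algebra: basis the nonempty words over \<open>X\<close>, product the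
  bilinear extension of concatenation.\<close>

definition free_assoc ::
  "('k, 'e) ring_scheme \<Rightarrow> 'x set \<Rightarrow> ('k, 'x list \<Rightarrow> 'k) module" where
  "free_assoc K X =
    (free_module K {w. w \<noteq> [] \<and> set w \<subseteq> X})
      \<lparr>mult := (\<lambda>f g w. \<Oplus>\<^bsub>K\<^esub> i \<in> {..length w}. f (take i w) \<otimes>\<^bsub>K\<^esub> g (drop i w))\<rparr>"

definition algebra_ideal ::
  "('k, 'e) ring_scheme \<Rightarrow> ('k, 'a) module \<Rightarrow> 'a set \<Rightarrow> bool" where
  "algebra_ideal K A I \<longleftrightarrow>
    submodule I K A \<and>
    (\<forall>a \<in> carrier A. \<forall>x \<in> I. a \<otimes>\<^bsub>A\<^esub> x \<in> I \<and> x \<otimes>\<^bsub>A\<^esub> a \<in> I)"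

definition perm_ideal ::
  "('k, 'e) ring_scheme \<Rightarrow> 'x set \<Rightarrow> ('x list \<Rightarrow> 'k) set" where
  "perm_ideal K X =
    (let F = free_assoc K X in
      \<Inter> {I. algebra_ideal K F I \<and>
            (\<forall>x \<in> carrier F. \<forall>y \<in> carrier F. \<forall>z \<in> carrier F.
              (x \<otimes>\<^bsub>F\<^esub> (y \<otimes>\<^bsub>F\<^esub> z)) \<ominus>\<^bsub>F\<^esub> (x \<otimes>\<^bsub>F\<^esub> (z \<otimes>\<^bsub>F\<^esub> y)) \<in> I)})"

definition Perm ::
  "('k, 'e) ring_scheme \<Rightarrow> 'x set \<Rightarrow> ('k, ('x list \<Rightarrow> 'k) set) module" where
  "Perm K X = quotient_module (free_assoc K X) (perm_ideal K X)"


subsection \<open>Pre-Lie algebras and bimodules\<close>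

definition pre_lie_algebra :: "('k, 'e) ring_scheme \<Rightarrow> ('k, 'p) module \<Rightarrow> bool" where
  "pre_lie_algebra K P \<longleftrightarrow>
    nonassoc_algebra K P \<and>
    (\<forall>a \<in> carrier P. \<forall>b \<in> carrier P. \<forall>c \<in> carrier P.
      ((a \<otimes>\<^bsub>P\<^esub> b) \<otimes>\<^bsub>P\<^esub> c) \<ominus>\<^bsub>P\<^esub> (a \<otimes>\<^bsub>P\<^esub> (b \<otimes>\<^bsub>P\<^esub> c)) =
      ((a \<otimes>\<^bsub>P\<^esub> c) \<otimes>\<^bsub>P\<^esub> b) \<ominus>\<^bsub>P\<^esub> (a \<otimes>\<^bsub>P\<^esub> (c \<otimes>\<^bsub>P\<^esub> b)))"

definition pre_lie_bimodule ::
  "('k, 'e) ring_scheme \<Rightarrow> ('k, 'p) module \<Rightarrow> ('k, 'n) module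
    \<Rightarrow> ('p \<Rightarrow> 'n \<Rightarrow> 'n) \<Rightarrow> ('n \<Rightarrow> 'p \<Rightarrow> 'n) \<Rightarrow> bool" where
  "pre_lie_bimodule K P N l r \<longleftrightarrow>
    module K N \<and> bilinear_map K P N N l \<and> bilinear_map K N P N r \<and>
    (\<forall>a \<in> carrier P. \<forall>b \<in> carrier P. \<forall>m \<in> carrier N.
      l (a \<otimes>\<^bsub>P\<^esub> b) m \<ominus>\<^bsub>N\<^esub> l a (l b m) = r (l a m) b \<ominus>\<^bsub>N\<^esub> l a (r m b) \<and>
      r (r m a) b \<ominus>\<^bsub>N\<^esub> r m (a \<otimes>\<^bsub>P\<^esub> b) = r (r m b) a \<ominus>\<^bsub>N\<^esub> r m (b \<otimes>\<^bsub>P\<^esub> a))"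


subsection \<open>Tensor products over the base field\<close>

definition tensor_relations ::
  "('k, 'e) ring_scheme \<Rightarrow> ('k, 'u) module \<Rightarrow> ('k, 'v) module \<Rightarrow> ('u \<times> 'v \<Rightarrow> 'k) set" where
  "tensor_relations K U V =
    (let F = free_module K (carrier U \<times> carrier V) in
      {delta K (u \<oplus>\<^bsub>U\<^esub> u', v) \<ominus>\<^bsub>F\<^esub> (delta K (u, v) \<oplus>\<^bsub>F\<^esub> delta K (u', v)) | u u' v.
          u \<in> carrier U \<and> u' \<in> carrier U \<and> v \<in> carrier V} \<union>
      {delta K (u, v \<oplus>\<^bsub>V\<^esub> v') \<ominus>\<^bsub>F\<^esub> (delta K (u, v) \<oplus>\<^bsub>F\<^esub> delta K (u, v')) | u v v'.
          u \<in> carrier U \<and> v \<in> carrier V \<and> v' \<in> carrier V} \<union>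
      {delta K (c \<odot>\<^bsub>U\<^esub> u, v) \<ominus>\<^bsub>F\<^esub> (c \<odot>\<^bsub>F\<^esub> delta K (u, v)) | c u v.
          c \<in> carrier K \<and> u \<in> carrier U \<and> v \<in> carrier V} \<union>
      {delta K (u, c \<odot>\<^bsub>V\<^esub> v) \<ominus>\<^bsub>F\<^esub> (c \<odot>\<^bsub>F\<^esub> delta K (u, v)) | c u v.
          c \<in> carrier K \<and> u \<in> carrier U \<and> v \<in> carrier V})"

definition tensor_kernel ::
  "('k, 'e) ring_scheme \<Rightarrow> ('k, 'u) module \<Rightarrow> ('k, 'v) module \<Rightarrow> ('u \<times> 'v \<Rightarrow> 'k) set" where
  "tensor_kernel K U V =
    \<Inter> {H. submodule H K (free_module K (carrier U \<times> carrier V)) \<and>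
          tensor_relations K U V \<subseteq> H}"

definition tensor_product ::
  "('k, 'e) ring_scheme \<Rightarrow> ('k, 'u) module \<Rightarrow> ('k, 'v) module
    \<Rightarrow> ('k, ('u \<times> 'v \<Rightarrow> 'k) set) module" where
  "tensor_product K U V =
    quotient_module (free_module K (carrier U \<times> carrier V)) (tensor_kernel K U V)"

definition pure_tensor ::
  "('k, 'e) ring_scheme \<Rightarrow> ('k, 'u) module \<Rightarrow> ('k, 'v) module
    \<Rightarrow> 'u \<Rightarrow> 'v \<Rightarrow> ('u \<times> 'v \<Rightarrow> 'k) set" where
  "pure_tensor K U V u v =
    tensor_kernel K U V +>\<^bsub>free_module K (carrier U \<times> carrier V)\<^esub> delta K (u, v)"


subsection \<open>Cochains and the map \<open>\<Psi>\<close>\<close>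

text \<open>An \<open>n\<close>-tuple is a list of length \<open>n\<close>; outside the tuples over \<open>V\<close> a multilinear map takes
  the value \<open>undefined\<close>, so that equality of maps is equality on tuples.\<close>

definition multilinear_maps ::
  "('k, 'e) ring_scheme \<Rightarrow> nat \<Rightarrow> ('k, 'v) module \<Rightarrow> ('k, 'w) module \<Rightarrow> ('v list \<Rightarrow> 'w) set" where
  "multilinear_maps K n V W =
    {F \<in> {vs. length vs = n \<and> set vs \<subseteq> carrier V} \<rightarrow>\<^sub>E carrier W.
      \<forall>vs i. length vs = n \<and> set vs \<subseteq> carrier V \<and> i < n \<longrightarrow>
        (\<forall>x \<in> carrier V. \<forall>y \<in> carrier V.
          F (vs[i := x \<oplus>\<^bsub>V\<^esub> y]) = F (vs[i := x]) \<oplus>\<^bsub>W\<^esub> F (vs[i := y])) \<and>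
        (\<forall>c \<in> carrier K. \<forall>x \<in> carrier V.
          F (vs[i := c \<odot>\<^bsub>V\<^esub> x]) = c \<odot>\<^bsub>W\<^esub> F (vs[i := x]))}"

definition C_Pre ::
  "('k, 'e) ring_scheme \<Rightarrow> ('k, 'p) module \<Rightarrow> ('k, 'n) module \<Rightarrow> nat \<Rightarrow> ('p list \<Rightarrow> 'n) set" where
  "C_Pre K P N n = multilinear_maps K n P N"

definition list_product :: "('k, 'a) module \<Rightarrow> 'a list \<Rightarrow> 'a" where
  "list_product A xs = foldl (mult A) (hd xs) (tl xs)"

text \<open>The value of \<open>\<Psi>(f)\<close> on \<open>a\<^sub>1 \<otimes> b\<^sub>1, \<dots>, a\<^sub>n \<otimes> b\<^sub>n\<close>, where \<open>as = [a\<^sub>1, \<dots>, a\<^sub>n]\<close> and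
  \<open>bs = [b\<^sub>1, \<dots>, b\<^sub>n]\<close>. List positions start at \<open>0\<close>, so \<open>b\<^sub>i\<close> is \<open>bs ! (i - 1)\<close>.\<close>

definition Psi_value ::
  "('k, 'e) ring_scheme \<Rightarrow> ('k, 'a) module \<Rightarrow> ('k, 'p) module \<Rightarrow> ('k, 'n) module
    \<Rightarrow> nat \<Rightarrow> ('p list \<Rightarrow> 'n) \<Rightarrow> 'a list \<Rightarrow> 'p list \<Rightarrow> ('a \<times> 'n \<Rightarrow> 'k) set" where
  "Psi_value K A P N n f as bs =
    (let T = tensor_product K A N;
         term = (\<lambda>as' bs'. pure_tensor K A N (list_product A as') (f bs'));
         sign = (\<lambda>i::nat. (\<ominus>\<^bsub>K\<^esub> \<one>\<^bsub>K\<^esub>) [^]\<^bsub>K\<^esub> i);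
         first = term as bs;
         second = term (as[0 := as ! 1, 1 := as ! 0]) (bs[0 := bs ! 1, 1 := bs ! 0]);
         middle = (\<Oplus>\<^bsub>T\<^esub> i \<in> {2..n - 2}. sign i \<odot>\<^bsub>T\<^esub>
           term (rev (take (i + 1) as) @ drop (i + 1) as)
                (take (i - 1) bs @ [bs ! i, bs ! (i - 1)] @ drop (i + 1) bs));
         last = sign (n - 1) \<odot>\<^bsub>T\<^esub> term (rev as) (rev bs)
     in if n = 1 then first
        else if n = 2 then first \<ominus>\<^bsub>T\<^esub> second
        else ((first \<ominus>\<^bsub>T\<^esub> second) \<oplus>\<^bsub>T\<^esub> middle) \<oplus>\<^bsub>T\<^esub> last)"

text \<open>\<open>\<Psi>(f)\<close> is the multilinear map with these values. It is taken in the space of all multilinear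
  maps: for \<open>n \<ge> 3\<close> the values above are in general not alternating, even if \<open>f\<close> alternates in its
  last \<open>n - 1\<close> arguments.\<close>

definition Psi ::
  "('k, 'e) ring_scheme \<Rightarrow> ('k, 'a) module \<Rightarrow> ('k, 'p) module \<Rightarrow> ('k, 'n) module
    \<Rightarrow> nat \<Rightarrow> ('p list \<Rightarrow> 'n) \<Rightarrow> ('a \<times> 'p \<Rightarrow> 'k) set list \<Rightarrow> ('a \<times> 'n \<Rightarrow> 'k) set" where
  "Psi K A P N n f =
    (THE F. F \<in> multilinear_maps K n (tensor_product K A P) (tensor_product K A N) \<and>
      (\<forall>as bs. length as = n \<and> set as \<subseteq> carrier A \<and> length bs = n \<and> set bs \<subseteq> carrier P \<longrightarrow>
        F (map2 (pure_tensor K A P) as bs) = Psi_value K A P N n f as bs))"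

end

theory Submission
  imports Defs
begin

text \<open>
  Let \<open>x \<noteq> y\<close> be generators of the free Perm algebra. Taking the coefficient of the word
  \<open>x y\<^sup>n\<^sup>-\<^sup>1\<close> is a well-defined linear functional \<open>c\<close> on \<open>A\<close>, because this word is the only one with
  first letter \<open>x\<close> and the same letters. Evaluate \<open>\<Psi>(f)\<close> on \<open>x \<otimes> b\<^sub>1, y \<otimes> b\<^sub>2, \<dots>, y \<otimes> b\<^sub>n\<close>: the first
  term is \<open>x y\<^sup>n\<^sup>-\<^sup>1 \<otimes> f(b\<^sub>1, \<dots>, b\<^sub>n)\<close>, and the word of every other term begins with \<open>y\<close>. Hence the contraction
  \<open>c \<otimes> id : A \<otimes> N \<rightarrow> N\<close> recovers \<open>f(b\<^sub>1, \<dots>, b\<^sub>n)\<close> from \<open>\<Psi>(f)\<close>.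

  That the description of \<open>\<Psi>(f)\<close> on pure tensors determines exactly one multilinear map follows
  by induction on \<open>n\<close>: uniqueness for \<open>n\<close> arguments makes the extension bilinear in the two factors
  of a further argument, so that the universal property of the tensor product applies to it.
\<close>

subsection \<open>Linear maps\<close>

text \<open>Two distinct generators are essential: over a single generator \<open>A\<close> is
  commutative, and in degree two \<open>Psi\<close> then annihilates every symmetric cochain.

  The coefficient functional is obtained without a normal form for Perm algebras. Since
  \<open>perm_ideal\<close> is an intersection, it suffices to exhibit one ideal that contains the
  Perm relations and on which the coefficient vanishes. The kernel of the coefficient alone is in
  general not closed under products, because a word can arise from shorter ones;
  \<open>power_null\<close> therefore takes in all words \<open>x y^m\<close> and
  \<open>y^m\<close>, a family that is closed under cutting a word in two.

  \<open>Psi\<close> is a definite description and has no usable value before exactly one map is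
  known to fit it. For existence, each term of \<open>Psi_value\<close> is seen as a product and a
  cochain, each composed with a rearrangement of its arguments.\<close>

definition linear_map ::
  "('k, 'e) ring_scheme \<Rightarrow> ('k, 'u) module \<Rightarrow> ('k, 'w) module \<Rightarrow> ('u \<Rightarrow> 'w) \<Rightarrow> bool" where
  "linear_map K U W h \<longleftrightarrow>
    (\<forall>x \<in> carrier U. h x \<in> carrier W) \<and>
    (\<forall>x \<in> carrier U. \<forall>y \<in> carrier U. h (x \<oplus>\<^bsub>U\<^esub> y) = h x \<oplus>\<^bsub>W\<^esub> h y) \<and>
    (\<forall>c \<in> carrier K. \<forall>x \<in> carrier U. h (c \<odot>\<^bsub>U\<^esub> x) = c \<odot>\<^bsub>W\<^esub> h x)"

lemma linear_mapI:
  assumes "\<And>x. x \<in> carrier U \<Longrightarrow> h x \<in> carrier W"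
    and "\<And>x y. x \<in> carrier U \<Longrightarrow> y \<in> carrier U \<Longrightarrow> h (x \<oplus>\<^bsub>U\<^esub> y) = h x \<oplus>\<^bsub>W\<^esub> h y"
    and "\<And>c x. c \<in> carrier K \<Longrightarrow> x \<in> carrier U \<Longrightarrow> h (c \<odot>\<^bsub>U\<^esub> x) = c \<odot>\<^bsub>W\<^esub> h x"
  shows "linear_map K U W h"
  using assms by (simp add: linear_map_def)

lemma linear_map_closed: "linear_map K U W h \<Longrightarrow> x \<in> carrier U \<Longrightarrow> h x \<in> carrier W"
  by (simp add: linear_map_def)

lemma linear_map_add:
  "linear_map K U W h \<Longrightarrow> x \<in> carrier U \<Longrightarrow> y \<in> carrier U \<Longrightarrow> h (x \<oplus>\<^bsub>U\<^esub> y) = h x \<oplus>\<^bsub>W\<^esub> h y"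
  by (simp add: linear_map_def)

lemma linear_map_smult:
  "linear_map K U W h \<Longrightarrow> c \<in> carrier K \<Longrightarrow> x \<in> carrier U \<Longrightarrow> h (c \<odot>\<^bsub>U\<^esub> x) = c \<odot>\<^bsub>W\<^esub> h x"
  by (simp add: linear_map_def)

lemma linear_map_cong:
  assumes U: "module K U" and "\<And>x. x \<in> carrier U \<Longrightarrow> h x = g x"
  shows "linear_map K U W h \<longleftrightarrow> linear_map K U W g"
proof -
  interpret U: module K U by (rule U)
  show ?thesis using assms(2) by (simp add: linear_map_def)
qed

lemma linear_map_compose:
  "linear_map K U V g \<Longrightarrow> linear_map K V W h \<Longrightarrow> linear_map K U W (\<lambda>x. h (g x))"
  by (simp add: linear_map_def)

text \<open>Slotwise form, through which sums and multiples of bilinear maps inherit bilinearity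
  from the linear case.\<close>

lemma bilinear_map_iff:
  "bilinear_map K U V W f \<longleftrightarrow>
    (\<forall>u \<in> carrier U. linear_map K V W (f u)) \<and> (\<forall>v \<in> carrier V. linear_map K U W (\<lambda>u. f u v))"
  unfolding bilinear_map_def linear_map_def by blast

context
  fixes K :: "('k, 'e) ring_scheme" and U :: "('k, 'u) module" and W :: "('k, 'w) module"
  assumes U: "module K U" and W: "module K W"
begin

interpretation U: module K U by (rule U)
interpretation W: module K W by (rule W)

lemma linear_map_zero: "linear_map K U W h \<Longrightarrow> h \<zero>\<^bsub>U\<^esub> = \<zero>\<^bsub>W\<^esub>"
  using linear_map_smult[of K U W h "\<zero>\<^bsub>K\<^esub>" "\<zero>\<^bsub>U\<^esub>"] linear_map_closed[of K U W h "\<zero>\<^bsub>U\<^esub>"] by simp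

lemma linear_map_a_inv:
  assumes h: "linear_map K U W h" and x: "x \<in> carrier U"
  shows "h (\<ominus>\<^bsub>U\<^esub> x) = \<ominus>\<^bsub>W\<^esub> h x"
proof (rule W.minus_equality[symmetric])
  show "h (\<ominus>\<^bsub>U\<^esub> x) \<oplus>\<^bsub>W\<^esub> h x = \<zero>\<^bsub>W\<^esub>"
    using linear_map_add[OF h, of "\<ominus>\<^bsub>U\<^esub> x" x] linear_map_zero[OF h] x by (simp add: U.l_neg)
qed (use linear_map_closed[OF h] x in auto)

lemma linear_map_minus:
  assumes h: "linear_map K U W h" and x: "x \<in> carrier U" and y: "y \<in> carrier U"
  shows "h (x \<ominus>\<^bsub>U\<^esub> y) = h x \<ominus>\<^bsub>W\<^esub> h y"
  using linear_map_add[OF h, of x "\<ominus>\<^bsub>U\<^esub> y"] linear_map_a_inv[OF h y] x y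
  by (simp add: a_minus_def)

lemma linear_map_finsum:
  assumes h: "linear_map K U W h" and "finite I" and "t \<in> I \<rightarrow> carrier U"
  shows "h (\<Oplus>\<^bsub>U\<^esub> i \<in> I. t i) = (\<Oplus>\<^bsub>W\<^esub> i \<in> I. h (t i))"
  using assms(2,3)
proof (induct I)
  case empty
  show ?case by (simp add: linear_map_zero[OF h])
next
  case (insert i I)
  then have "t i \<in> carrier U" "t \<in> I \<rightarrow> carrier U" by auto
  with insert show ?case
    using linear_map_closed[OF h] linear_map_add[OF h] by (simp add: Pi_iff)
qed

lemma linear_map_zero_map: "linear_map K U W (\<lambda>x. \<zero>\<^bsub>W\<^esub>)"
  by (rule linear_mapI) simp_all

lemma linear_map_plus:
  assumes "linear_map K U W g" and "linear_map K U W h"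
  shows "linear_map K U W (\<lambda>x. g x \<oplus>\<^bsub>W\<^esub> h x)"
  using assms
  by (intro linear_mapI)
    (auto simp: linear_map_closed linear_map_add linear_map_smult W.smult_r_distr W.a_ac)

lemma linear_map_scale:
  assumes "c \<in> carrier K" and "linear_map K U W h"
  shows "linear_map K U W (\<lambda>x. c \<odot>\<^bsub>W\<^esub> h x)"
  using assms
  by (intro linear_mapI)
    (auto simp: linear_map_closed linear_map_add linear_map_smult W.smult_r_distr
      W.smult_assoc1[symmetric] U.R.m_comm)

text \<open>Turns agreement on a spanning set into equality everywhere: no proper submodule contains
  a spanning set.\<close>

lemma submodule_equalizer:
  assumes g: "linear_map K U W g" and h: "linear_map K U W h"
  shows "submodule {x \<in> carrier U. g x = h x} K U"
  by (rule U.submoduleI)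
    (auto simp: linear_map_zero[OF g] linear_map_zero[OF h] linear_map_a_inv[OF g] linear_map_a_inv[OF h]
      linear_map_add[OF g] linear_map_add[OF h] linear_map_smult[OF g] linear_map_smult[OF h])

lemma submodule_kernel:
  assumes h: "linear_map K U W h"
  shows "submodule {x \<in> carrier U. h x = \<zero>\<^bsub>W\<^esub>} K U"
  by (rule submodule_equalizer[OF h linear_map_zero_map])

end

text \<open>Both \<open>tensor_kernel\<close> and \<open>perm_ideal\<close> are intersections of
  this kind. Nonemptiness keeps the intersection inside \<open>carrier V\<close>, since an empty
  intersection is \<open>UNIV\<close>.\<close>

lemma submodule_Inter:
  assumes "module K V" and "S \<noteq> {}" and "\<And>H. H \<in> S \<Longrightarrow> submodule H K V"
  shows "submodule (\<Inter>S) K V"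
proof -
  interpret module K V by fact
  have zero: "\<zero>\<^bsub>V\<^esub> \<in> H" if "H \<in> S" for H
    using subgroup.one_closed[OF submodule.axioms(1)[OF assms(3)[OF that]]] by simp
  have "H \<subseteq> carrier V" if "H \<in> S" for H
    using submoduleE(1)[OF assms(3)[OF that]] .
  then have "\<Inter>S \<subseteq> carrier V"
    using assms(2) by blast
  then show ?thesis
    using submoduleE(3-5)[OF assms(3)] by (intro submoduleI) (auto simp: zero)
qed

text \<open>The locale \<open>module\<close> never looks at the product or at \<open>one\<close>, so
  installing concatenation as product, as in \<open>free_assoc\<close>, keeps the vector space
  structure.\<close>

lemma module_change_mult:
  fixes V :: "('k, 'v) module"
  assumes "module K V" and "carrier V' = carrier V" and "zero V' = zero V" and "add V' = add V"
    and "smult V' = smult V"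
  shows "module K (V' :: ('k, 'v) module)"
proof -
  interpret module K V by fact
  have "abelian_group V'"
    by (rule abelian_groupI) (use assms(2-) in \<open>auto simp: M.a_ac intro: M.l_neg\<close>)
  then show ?thesis
    using assms(2-) R.is_cring
    by (intro moduleI) (auto simp: smult_l_distr smult_r_distr smult_assoc1)
qed

subsection \<open>Quotient modules\<close>

context
  fixes K :: "('k, 'e) ring_scheme" and V :: "('k, 'v) module" and H :: "'v set"
  assumes V: "module K V" and H: "submodule H K V"
begin

interpretation V: module K V by (rule V)
interpretation H: abelian_subgroup H V
  by (rule abelian_subgroupI3)
    (simp_all add: additive_subgroupI submodule.axioms(1)[OF H] V.M.abelian_group_axioms)

lemma coset_eq_iff:
  assumes x: "x \<in> carrier V" and y: "y \<in> carrier V"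
  shows "H +>\<^bsub>V\<^esub> x = H +>\<^bsub>V\<^esub> y \<longleftrightarrow> x \<ominus>\<^bsub>V\<^esub> y \<in> H"
proof -
  have "H +>\<^bsub>V\<^esub> x = H +>\<^bsub>V\<^esub> y \<longleftrightarrow> x \<in> H +>\<^bsub>V\<^esub> y"
    using H.a_rcos_self[OF x] H.a_repr_independence'[OF _ y] by auto
  also have "\<dots> \<longleftrightarrow> x \<ominus>\<^bsub>V\<^esub> y \<in> H"
    using H.a_rcos_module[OF y x] by (simp add: a_minus_def)
  finally show ?thesis .
qed

lemma coset_self: "x \<in> carrier V \<Longrightarrow> x \<in> H +>\<^bsub>V\<^esub> x"
  by (rule H.a_rcos_self)

lemma coset_memD:
  assumes "x \<in> carrier V" and "y \<in> H +>\<^bsub>V\<^esub> x"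
  shows "y \<in> carrier V" and "H +>\<^bsub>V\<^esub> y = H +>\<^bsub>V\<^esub> x"
  using assms H.a_elemrcos_carrier H.a_repr_independence' by blast+

lemma quotient_module_carrier:
  "carrier (quotient_module V H) = (\<lambda>x. H +>\<^bsub>V\<^esub> x) ` carrier V"
  by (auto simp: quotient_module_def A_RCOSETS_def' )

lemma quotient_module_add:
  "x \<in> carrier V \<Longrightarrow> y \<in> carrier V \<Longrightarrow>
    (H +>\<^bsub>V\<^esub> x) \<oplus>\<^bsub>quotient_module V H\<^esub> (H +>\<^bsub>V\<^esub> y) = H +>\<^bsub>V\<^esub> (x \<oplus>\<^bsub>V\<^esub> y)"
  by (simp add: quotient_module_def H.a_rcos_sum)

lemma quotient_module_zero: "\<zero>\<^bsub>quotient_module V H\<^esub> = H +>\<^bsub>V\<^esub> \<zero>\<^bsub>V\<^esub>"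
  using H.a_rcos_const[OF H.zero_closed] by (simp add: quotient_module_def)

text \<open>Scalar multiplication on the quotient is a union over all representatives; the members
  of that union coincide because \<open>c\<close> maps the difference of \<open>v\<close> and
  \<open>x\<close> back into \<open>H\<close>.\<close>

lemma coset_smult_cong:
  assumes "x \<in> carrier V" and "v \<in> H +>\<^bsub>V\<^esub> x" and c: "c \<in> carrier K"
  shows "H +>\<^bsub>V\<^esub> (c \<odot>\<^bsub>V\<^esub> v) = H +>\<^bsub>V\<^esub> (c \<odot>\<^bsub>V\<^esub> x)"
proof -
  have v: "v \<in> carrier V" and "v \<ominus>\<^bsub>V\<^esub> x \<in> H"
    using assms H.a_elemrcos_carrier H.a_rcos_module_imp by (auto simp: a_minus_def)
  then have "c \<odot>\<^bsub>V\<^esub> (v \<ominus>\<^bsub>V\<^esub> x) \<in> H"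
    using c V.submoduleE(4)[OF H] by blast
  then have "c \<odot>\<^bsub>V\<^esub> v \<ominus>\<^bsub>V\<^esub> c \<odot>\<^bsub>V\<^esub> x \<in> H"
    using assms v by (simp add: a_minus_def V.smult_r_distr V.smult_r_minus)
  then show ?thesis
    using assms v by (simp add: coset_eq_iff)
qed

lemma quotient_module_smult:
  assumes x: "x \<in> carrier V" and c: "c \<in> carrier K"
  shows "c \<odot>\<^bsub>quotient_module V H\<^esub> (H +>\<^bsub>V\<^esub> x) = H +>\<^bsub>V\<^esub> (c \<odot>\<^bsub>V\<^esub> x)"
proof -
  have "(\<Union>v \<in> H +>\<^bsub>V\<^esub> x. H +>\<^bsub>V\<^esub> (c \<odot>\<^bsub>V\<^esub> v)) = (\<Union>v \<in> H +>\<^bsub>V\<^esub> x. H +>\<^bsub>V\<^esub> (c \<odot>\<^bsub>V\<^esub> x))"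
    using coset_smult_cong[OF x _ c] by (intro SUP_cong refl)
  also have "\<dots> = H +>\<^bsub>V\<^esub> (c \<odot>\<^bsub>V\<^esub> x)"
    using H.a_rcos_self[OF x] by blast
  finally show ?thesis by (simp add: quotient_module_def)
qed

lemma module_quotient_module: "module K (quotient_module V H)"
proof -
  have "abelian_group (quotient_module V H)"
  proof (rule abelian_groupI)
    fix C assume "C \<in> carrier (quotient_module V H)"
    then obtain x where x: "x \<in> carrier V" "C = H +>\<^bsub>V\<^esub> x" by (auto simp: quotient_module_carrier)
    then show "\<exists>D \<in> carrier (quotient_module V H). D \<oplus>\<^bsub>quotient_module V H\<^esub> C = \<zero>\<^bsub>quotient_module V H\<^esub>"
      by (intro bexI[of _ "H +>\<^bsub>V\<^esub> (\<ominus>\<^bsub>V\<^esub> x)"])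
        (auto simp: quotient_module_carrier quotient_module_add quotient_module_zero V.M.l_neg)
  qed (auto simp: quotient_module_carrier quotient_module_add quotient_module_zero V.M.a_ac)
  then show ?thesis
    using V.R.is_cring
    by (intro moduleI) (auto simp: quotient_module_carrier quotient_module_add quotient_module_smult
      V.smult_l_distr V.smult_r_distr V.smult_assoc1)
qed

lemma linear_map_coset: "linear_map K V (quotient_module V H) (\<lambda>x. H +>\<^bsub>V\<^esub> x)"
  by (rule linear_mapI)
    (auto simp: quotient_module_carrier quotient_module_add quotient_module_smult)

text \<open>Universal property of the quotient: evaluating \<open>h\<close> at a chosen
  representative is well defined, since two representatives differ by an element of
  \<open>H\<close>.\<close>

lemma linear_map_factor:
  assumes W: "module K W" and h: "linear_map K V W h" and ker: "\<And>x. x \<in> H \<Longrightarrow> h x = \<zero>\<^bsub>W\<^esub>"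
  obtains g where "linear_map K (quotient_module V H) W g"
    and "\<And>x. x \<in> carrier V \<Longrightarrow> g (H +>\<^bsub>V\<^esub> x) = h x"
proof -
  interpret W: module K W by (rule W)
  define g where "g C = h (SOME v. v \<in> C)" for C
  have g: "g (H +>\<^bsub>V\<^esub> x) = h x" if x: "x \<in> carrier V" for x
  proof -
    define v where "v = (SOME v. v \<in> H +>\<^bsub>V\<^esub> x)"
    have "v \<in> H +>\<^bsub>V\<^esub> x"
      unfolding v_def using H.a_rcos_self[OF x] by (rule someI)
    then have v: "v \<in> carrier V" and "v \<ominus>\<^bsub>V\<^esub> x \<in> H"
      using x H.a_elemrcos_carrier H.a_rcos_module_imp by (auto simp: a_minus_def)
    then have "h v \<ominus>\<^bsub>W\<^esub> h x = \<zero>\<^bsub>W\<^esub>"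
      using ker linear_map_minus[OF V W h v x] by simp
    then have "h v = h x"
      using linear_map_closed[OF h] v x W.M.minus_equality[of "h v" "\<ominus>\<^bsub>W\<^esub> h x"]
      by (simp add: a_minus_def)
    then show ?thesis by (simp add: g_def v_def)
  qed
  have "linear_map K (quotient_module V H) W g"
    by (rule linear_mapI)
      (auto simp: quotient_module_carrier quotient_module_add quotient_module_smult g
        linear_map_closed[OF h] linear_map_add[OF h] linear_map_smult[OF h])
  with g that show ?thesis by blast
qed

end

subsection \<open>Free modules and tensor products\<close>

context
  fixes K :: "('k, 'e) ring_scheme" and S :: "'s set"
  assumes K: "cring K"
begin

interpretation K: cring K by (rule K)

lemma finite_support_add:
  assumes "finite {s. f s \<noteq> \<zero>\<^bsub>K\<^esub>}" and "finite {s. g s \<noteq> \<zero>\<^bsub>K\<^esub>}"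
  shows "finite {s. f s \<oplus>\<^bsub>K\<^esub> g s \<noteq> \<zero>\<^bsub>K\<^esub>}"
  by (rule finite_subset[OF _ finite_UnI[OF assms]]) auto

lemma finite_support_smult:
  assumes "finite {s. f s \<noteq> \<zero>\<^bsub>K\<^esub>}" and "c \<in> carrier K"
  shows "finite {s. c \<otimes>\<^bsub>K\<^esub> f s \<noteq> \<zero>\<^bsub>K\<^esub>}"
  by (rule finite_subset[OF _ assms(1)]) (use assms(2) in auto)

lemma module_free_module: "module K (free_module K S)"
proof -
  have "abelian_group (free_module K S)"
  proof (rule abelian_groupI)
    fix f assume f: "f \<in> carrier (free_module K S)"
    have "{s. \<ominus>\<^bsub>K\<^esub> f s \<noteq> \<zero>\<^bsub>K\<^esub>} \<subseteq> {s. f s \<noteq> \<zero>\<^bsub>K\<^esub>}" by auto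
    moreover have "finite {s. f s \<noteq> \<zero>\<^bsub>K\<^esub>}"
      using f by (simp add: free_module_def)
    ultimately have "finite {s. \<ominus>\<^bsub>K\<^esub> f s \<noteq> \<zero>\<^bsub>K\<^esub>}" by (rule finite_subset)
    with f
    show "\<exists>g \<in> carrier (free_module K S). g \<oplus>\<^bsub>free_module K S\<^esub> f = \<zero>\<^bsub>free_module K S\<^esub>"
      by (intro bexI[of _ "\<lambda>s. \<ominus>\<^bsub>K\<^esub> f s"]) (auto simp: free_module_def K.l_neg)
  qed (auto simp: free_module_def finite_support_add K.a_ac)
  then show ?thesis
    using K.is_cring
    by (intro moduleI)
      (auto simp: free_module_def finite_support_smult K.l_distr K.r_distr K.m_assoc)
qed

lemma free_module_add: "f \<oplus>\<^bsub>free_module K S\<^esub> g = (\<lambda>s. f s \<oplus>\<^bsub>K\<^esub> g s)"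
  by (simp add: free_module_def)

lemma free_module_smult: "c \<odot>\<^bsub>free_module K S\<^esub> f = (\<lambda>s. c \<otimes>\<^bsub>K\<^esub> f s)"
  by (simp add: free_module_def)

lemma delta_closed: "s \<in> S \<Longrightarrow> delta K s \<in> carrier (free_module K S)"
  by (auto simp: free_module_def delta_def)

text \<open>Splitting off one basis vector at a time exhausts the finite support, so the vectors
  \<open>delta K s\<close> span the free module.\<close>

lemma free_module_induct:
  assumes H: "submodule H K (free_module K S)" and delta: "\<And>s. s \<in> S \<Longrightarrow> delta K s \<in> H"
  shows "H = carrier (free_module K S)"
proof -
  interpret F: module K "free_module K S" by (rule module_free_module)
  note E = F.submoduleE[OF H]
  have zero: "(\<lambda>s. \<zero>\<^bsub>K\<^esub>) \<in> H"
    using subgroup.one_closed[OF submodule.axioms(1)[OF H]] by (simp add: free_module_def)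
  \<comment> \<open>\<open>B\<close> only has to contain the support, so the induction also passes a
    point \<open>b\<close> at which \<open>f\<close> already vanishes.\<close>
  have main: "f \<in> carrier (free_module K S) \<Longrightarrow> {s. f s \<noteq> \<zero>\<^bsub>K\<^esub>} \<subseteq> B \<Longrightarrow> f \<in> H" if "finite B" for B f
    using that
  proof (induct B arbitrary: f)
    case empty
    then have "f = (\<lambda>s. \<zero>\<^bsub>K\<^esub>)" by auto
    with zero show ?case by simp
  next
    case (insert b B)
    define g where "g = f(b := \<zero>\<^bsub>K\<^esub>)"
    have f: "\<And>s. f s \<in> carrier K" and "finite {s. f s \<noteq> \<zero>\<^bsub>K\<^esub>}"
      using insert.prems(1) by (auto simp: free_module_def)
    moreover have "{s. g s \<noteq> \<zero>\<^bsub>K\<^esub>} \<subseteq> {s. f s \<noteq> \<zero>\<^bsub>K\<^esub>}"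
      by (auto simp: g_def)
    ultimately have "finite {s. g s \<noteq> \<zero>\<^bsub>K\<^esub>}" by (blast intro: finite_subset)
    then have "g \<in> carrier (free_module K S)"
      using insert.prems(1) by (auto simp: free_module_def g_def)
    moreover have "{s. g s \<noteq> \<zero>\<^bsub>K\<^esub>} \<subseteq> B"
      using insert.prems(2) by (auto simp: g_def)
    ultimately have g: "g \<in> H" by (rule insert.hyps(3))
    show ?case
    proof (cases "b \<in> S")
      case True
      have "f = g \<oplus>\<^bsub>free_module K S\<^esub> (f b \<odot>\<^bsub>free_module K S\<^esub> delta K b)"
        using f by (auto simp: free_module_def delta_def g_def)
      with g True f delta show ?thesis
        by (metis E(4,5))
    next
      case False
      then have "f = g"
        using insert.prems(1) by (auto simp: free_module_def g_def)
      with g show ?thesis by simp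
    qed
  qed
  show ?thesis
  proof
    show "carrier (free_module K S) \<subseteq> H"
      using main by (auto simp: free_module_def)
  qed (rule E(1))
qed

lemma free_module_lift:
  assumes W: "module K W" and \<phi>: "\<phi> \<in> S \<rightarrow> carrier W"
  obtains h where "linear_map K (free_module K S) W h" and "\<And>s. s \<in> S \<Longrightarrow> h (delta K s) = \<phi> s"
proof -
  interpret W: module K W by (rule W)
  define h where "h f = (\<Oplus>\<^bsub>W\<^esub> s \<in> {s. f s \<noteq> \<zero>\<^bsub>K\<^esub>}. f s \<odot>\<^bsub>W\<^esub> \<phi> s)" for f
  have closed: "f s \<odot>\<^bsub>W\<^esub> \<phi> s \<in> carrier W" if "f \<in> carrier (free_module K S)" "s \<in> S" for f s
    using that \<phi> by (auto simp: free_module_def)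
  have supp: "{s. f s \<noteq> \<zero>\<^bsub>K\<^esub>} \<subseteq> S" "finite {s. f s \<noteq> \<zero>\<^bsub>K\<^esub>}" if "f \<in> carrier (free_module K S)" for f
    using that by (auto simp: free_module_def)
  \<comment> \<open>The sum may run over any finite superset of the support inside \<open>S\<close>;
    additivity needs a common index set for \<open>f\<close>, \<open>g\<close> and their
    sum.\<close>
  have h: "h f = (\<Oplus>\<^bsub>W\<^esub> s \<in> B. f s \<odot>\<^bsub>W\<^esub> \<phi> s)"
    if "f \<in> carrier (free_module K S)" "finite B" "{s. f s \<noteq> \<zero>\<^bsub>K\<^esub>} \<subseteq> B" "B \<subseteq> S" for f B
    unfolding h_def using that \<phi> closed[OF that(1)]
    by (intro W.M.add.finprod_mono_neutral_cong_left) (auto simp: Pi_iff subset_iff)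
  have "linear_map K (free_module K S) W h"
  proof (rule linear_mapI)
    fix f assume f: "f \<in> carrier (free_module K S)"
    show "h f \<in> carrier W"
      unfolding h_def using closed[OF f] supp[OF f] by (intro W.M.finsum_closed) auto
    fix g assume g: "g \<in> carrier (free_module K S)"
    let ?B = "{s. f s \<noteq> \<zero>\<^bsub>K\<^esub>} \<union> {s. g s \<noteq> \<zero>\<^bsub>K\<^esub>}"
    have B: "finite ?B" "?B \<subseteq> S"
      using supp[OF f] supp[OF g] by auto
    have fg: "f s \<in> carrier K" "g s \<in> carrier K" for s
      using f g by (auto simp: free_module_def)
    interpret F: module K "free_module K S" by (rule module_free_module)
    have "h (f \<oplus>\<^bsub>free_module K S\<^esub> g) = (\<Oplus>\<^bsub>W\<^esub> s \<in> ?B. (f s \<oplus>\<^bsub>K\<^esub> g s) \<odot>\<^bsub>W\<^esub> \<phi> s)"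
      by (subst h[OF F.M.a_closed[OF f g] B(1) _ B(2)]) (auto simp: free_module_add)
    also have "\<dots> = (\<Oplus>\<^bsub>W\<^esub> s \<in> ?B. f s \<odot>\<^bsub>W\<^esub> \<phi> s \<oplus>\<^bsub>W\<^esub> g s \<odot>\<^bsub>W\<^esub> \<phi> s)"
      using B \<phi> fg closed[OF f] closed[OF g]
      by (intro W.M.finsum_cong') (auto simp: Pi_iff subset_iff W.smult_l_distr)
    also have "\<dots> = h f \<oplus>\<^bsub>W\<^esub> h g"
      using B closed[OF f] closed[OF g] h[OF f, of ?B] h[OF g, of ?B]
      by (subst W.M.finsum_addf) (auto simp: subset_iff)
    finally show "h (f \<oplus>\<^bsub>free_module K S\<^esub> g) = h f \<oplus>\<^bsub>W\<^esub> h g" .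
  next
    fix c f assume c: "c \<in> carrier K" and f: "f \<in> carrier (free_module K S)"
    let ?B = "{s. f s \<noteq> \<zero>\<^bsub>K\<^esub>}"
    have B: "finite ?B" "?B \<subseteq> S"
      using supp[OF f] by auto
    have fs: "f s \<in> carrier K" for s
      using f by (auto simp: free_module_def)
    interpret F: module K "free_module K S" by (rule module_free_module)
    have "h (c \<odot>\<^bsub>free_module K S\<^esub> f) = (\<Oplus>\<^bsub>W\<^esub> s \<in> ?B. (c \<otimes>\<^bsub>K\<^esub> f s) \<odot>\<^bsub>W\<^esub> \<phi> s)"
      using c by (subst h[OF F.smult_closed[OF c f] B(1) _ B(2)]) (auto simp: free_module_smult)
    also have "\<dots> = (\<Oplus>\<^bsub>W\<^esub> s \<in> ?B. c \<odot>\<^bsub>W\<^esub> (f s \<odot>\<^bsub>W\<^esub> \<phi> s))"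
      using B \<phi> fs c closed[OF f]
      by (intro W.M.finsum_cong') (auto simp: Pi_iff subset_iff W.smult_assoc1)
    also have "\<dots> = c \<odot>\<^bsub>W\<^esub> h f"
      unfolding h_def using B c closed[OF f] by (intro W.finsum_smult_ldistr[symmetric]) auto
    finally show "h (c \<odot>\<^bsub>free_module K S\<^esub> f) = c \<odot>\<^bsub>W\<^esub> h f" .
  qed
  moreover have "h (delta K s) = \<phi> s" if s: "s \<in> S" for s
  proof -
    have "h (delta K s) = (\<Oplus>\<^bsub>W\<^esub> t \<in> {s}. delta K s t \<odot>\<^bsub>W\<^esub> \<phi> t)"
      using s by (intro h delta_closed) (auto simp: delta_def)
    also have "\<dots> = \<phi> s"
      using s \<phi> by (subst W.M.finsum_insert) (auto simp: delta_def Pi_iff)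
    finally show ?thesis .
  qed
  ultimately show ?thesis using that by blast
qed

end

section \<open>Tensor products and their universal property\<close>

context
  fixes K :: "('k, 'e) ring_scheme" and U :: "('k, 'u) module" and V :: "('k, 'v) module"
  assumes U: "module K U" and V: "module K V"
begin

interpretation U: module K U by (rule U)
interpretation V: module K V by (rule V)

private abbreviation (input) "FUV \<equiv> free_module K (carrier U \<times> carrier V)"

interpretation FUV: module K FUV by (rule module_free_module[OF U.R.is_cring])

private lemma pair_closed: "u \<in> carrier U \<Longrightarrow> v \<in> carrier V \<Longrightarrow> delta K (u, v) \<in> carrier FUV"
  by (simp add: delta_closed[OF U.R.is_cring])

lemma submodule_tensor_kernel: "submodule (tensor_kernel K U V) K FUV"
  unfolding tensor_kernel_def
proof (rule submodule_Inter[OF FUV.module_axioms])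
  have "tensor_relations K U V \<subseteq> carrier FUV"
    unfolding tensor_relations_def Let_def by (auto simp: pair_closed)
  then show "{H. submodule H K FUV \<and> tensor_relations K U V \<subseteq> H} \<noteq> {}"
    using FUV.carrier_is_submodule by blast
qed auto

lemma tensor_kernel_subset: "submodule H K FUV \<Longrightarrow> tensor_relations K U V \<subseteq> H \<Longrightarrow> tensor_kernel K U V \<subseteq> H"
  unfolding tensor_kernel_def by blast

lemma module_tensor_product: "module K (tensor_product K U V)"
  unfolding tensor_product_def
  by (rule module_quotient_module[OF FUV.module_axioms submodule_tensor_kernel])

text \<open>The four families in \<open>tensor_relations\<close> are the four bilinearity
  identities, read as differences that vanish in the quotient.\<close>

lemma bilinear_map_pure_tensor: "bilinear_map K U V (tensor_product K U V) (pure_tensor K U V)"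
proof -
  let ?H = "tensor_kernel K U V"
  have rel: "tensor_relations K U V \<subseteq> ?H"
    unfolding tensor_kernel_def by blast
  have add1: "delta K (u \<oplus>\<^bsub>U\<^esub> u', v) \<ominus>\<^bsub>FUV\<^esub> (delta K (u, v) \<oplus>\<^bsub>FUV\<^esub> delta K (u', v)) \<in> ?H"
    if "u \<in> carrier U" "u' \<in> carrier U" "v \<in> carrier V" for u u' v
    by (rule subsetD[OF rel], unfold tensor_relations_def Let_def,
        rule UnI1, rule UnI1, rule UnI1, rule CollectI,
        intro exI conjI, rule refl) (use that in simp_all)
  have add2: "delta K (u, v \<oplus>\<^bsub>V\<^esub> v') \<ominus>\<^bsub>FUV\<^esub> (delta K (u, v) \<oplus>\<^bsub>FUV\<^esub> delta K (u, v')) \<in> ?H"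
    if "u \<in> carrier U" "v \<in> carrier V" "v' \<in> carrier V" for u v v'
    by (rule subsetD[OF rel], unfold tensor_relations_def Let_def,
        rule UnI1, rule UnI1, rule UnI2, rule CollectI,
        intro exI conjI, rule refl) (use that in simp_all)
  have smult1: "delta K (c \<odot>\<^bsub>U\<^esub> u, v) \<ominus>\<^bsub>FUV\<^esub> (c \<odot>\<^bsub>FUV\<^esub> delta K (u, v)) \<in> ?H"
    and smult2: "delta K (u, c \<odot>\<^bsub>V\<^esub> v) \<ominus>\<^bsub>FUV\<^esub> (c \<odot>\<^bsub>FUV\<^esub> delta K (u, v)) \<in> ?H"
    if "c \<in> carrier K" "u \<in> carrier U" "v \<in> carrier V" for c u v
    subgoal
      by (rule subsetD[OF rel], unfold tensor_relations_def Let_def,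
          rule UnI1, rule UnI2, rule CollectI,
          intro exI conjI, rule refl) (use that in simp_all)
    subgoal
      by (rule subsetD[OF rel], unfold tensor_relations_def Let_def,
          rule UnI2, rule CollectI,
          intro exI conjI, rule refl) (use that in simp_all)
    done
  note q = quotient_module_carrier[OF FUV.module_axioms submodule_tensor_kernel]
    quotient_module_add[OF FUV.module_axioms submodule_tensor_kernel]
    quotient_module_smult[OF FUV.module_axioms submodule_tensor_kernel]
    coset_eq_iff[OF FUV.module_axioms submodule_tensor_kernel]
  show ?thesis
    unfolding bilinear_map_def tensor_product_def pure_tensor_def
    by (intro conjI ballI) (simp_all add: q pair_closed add1 add2 smult1 smult2)
qed

text \<open>Uniqueness half of the universal property. Pulled back along the coset map, both maps
  agree on the basis \<open>delta K (u, v)\<close> of the free module, whose images are the pure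
  tensors.\<close>

lemma tensor_product_ext:
  assumes W: "module K W" and g: "linear_map K (tensor_product K U V) W g"
    and h: "linear_map K (tensor_product K U V) W h"
    and eq: "\<And>u v. u \<in> carrier U \<Longrightarrow> v \<in> carrier V \<Longrightarrow> g (pure_tensor K U V u v) = h (pure_tensor K U V u v)"
    and t: "t \<in> carrier (tensor_product K U V)"
  shows "g t = h t"
proof -
  let ?q = "\<lambda>x. tensor_kernel K U V +>\<^bsub>FUV\<^esub> x"
  have q: "linear_map K FUV (tensor_product K U V) ?q"
    unfolding tensor_product_def
    by (rule linear_map_coset[OF FUV.module_axioms submodule_tensor_kernel])
  have "{x \<in> carrier FUV. g (?q x) = h (?q x)} = carrier FUV"
    by (rule free_module_induct[OF U.R.is_cring]
        submodule_equalizer[OF FUV.module_axioms W linear_map_compose[OF q g] linear_map_compose[OF q h]])+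
      (use eq in \<open>auto simp: pair_closed pure_tensor_def\<close>)
  moreover obtain x where "x \<in> carrier FUV" "t = ?q x"
    using t quotient_module_carrier[OF FUV.module_axioms submodule_tensor_kernel]
    by (auto simp: tensor_product_def)
  ultimately show ?thesis by blast
qed

text \<open>Existence half of the universal property: the linear extension of \<open>f\<close> from
  the basis of pairs kills every relation by bilinearity, hence factors through the
  quotient.\<close>

lemma tensor_product_lift:
  assumes W: "module K W" and f: "bilinear_map K U V W f"
  shows "\<exists>h. linear_map K (tensor_product K U V) W h \<and>
    (\<forall>u \<in> carrier U. \<forall>v \<in> carrier V. h (pure_tensor K U V u v) = f u v)"
proof -
  have "(\<lambda>(u, v). f u v) \<in> carrier U \<times> carrier V \<rightarrow> carrier W"
    using f by (auto simp: bilinear_map_def)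
  then obtain h where h: "linear_map K FUV W h"
    and h_delta: "\<And>s. s \<in> carrier U \<times> carrier V \<Longrightarrow> h (delta K s) = (\<lambda>(u, v). f u v) s"
    using free_module_lift[OF U.R.is_cring W] by blast
  interpret W: module K W by (rule W)
  let ?N = "{x \<in> carrier FUV. h x = \<zero>\<^bsub>W\<^esub>}"
  have "tensor_relations K U V \<subseteq> ?N"
    using f unfolding tensor_relations_def Let_def
    by (auto simp: pair_closed linear_map_a_inv[OF FUV.module_axioms W h] linear_map_add[OF h]
        linear_map_smult[OF h] h_delta bilinear_map_def a_minus_def W.M.r_neg)
  then have "tensor_kernel K U V \<subseteq> ?N"
    by (rule tensor_kernel_subset[OF submodule_kernel[OF FUV.module_axioms W h]])
  then obtain g where "linear_map K (tensor_product K U V) W g"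
    and "\<And>x. x \<in> carrier FUV \<Longrightarrow> g (tensor_kernel K U V +>\<^bsub>FUV\<^esub> x) = h x"
    using linear_map_factor[OF FUV.module_axioms submodule_tensor_kernel W h]
    unfolding tensor_product_def by blast
  with h_delta show ?thesis
    by (intro exI[of _ g]) (simp add: pure_tensor_def pair_closed)
qed

end

subsection \<open>Multilinear maps on tensor products\<close>

text \<open>Multilinearity without the demand of being \<open>undefined\<close> off the tuples.
  Pointwise sums, multiples and maps such as \<open>\<lambda>vs. F (x # vs)\<close> stay in this
  class, whereas in general they leave \<open>multilinear_maps\<close>.\<close>

definition multilinear_on ::
  "('k, 'e) ring_scheme \<Rightarrow> nat \<Rightarrow> ('k, 'v) module \<Rightarrow> ('k, 'w) module \<Rightarrow> ('v list \<Rightarrow> 'w) \<Rightarrow> bool" where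
  "multilinear_on K n V W F \<longleftrightarrow>
    (\<forall>vs. length vs = n \<and> set vs \<subseteq> carrier V \<longrightarrow>
      F vs \<in> carrier W \<and> (\<forall>i < n. linear_map K V W (\<lambda>x. F (vs[i := x]))))"

lemma multilinear_onD:
  assumes "multilinear_on K n V W F" and "length vs = n" and "set vs \<subseteq> carrier V"
  shows "F vs \<in> carrier W" and "i < n \<Longrightarrow> linear_map K V W (\<lambda>x. F (vs[i := x]))"
  using assms by (simp_all add: multilinear_on_def)

lemma set_list_update_subsetI: "set xs \<subseteq> S \<Longrightarrow> x \<in> S \<Longrightarrow> set (xs[i := x]) \<subseteq> S"
  using set_update_subset_insert[of xs i x] by blast

lemma multilinear_maps_iff:
  "F \<in> multilinear_maps K n V W \<longleftrightarrow>
    F \<in> extensional {vs. length vs = n \<and> set vs \<subseteq> carrier V} \<and> multilinear_on K n V W F"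
  unfolding multilinear_maps_def multilinear_on_def linear_map_def PiE_def
  by (auto simp: set_list_update_subsetI Pi_iff)

lemma restrict_multilinear_maps:
  assumes "module K V" and F: "multilinear_on K n V W F"
  shows "restrict F {vs. length vs = n \<and> set vs \<subseteq> carrier V} \<in> multilinear_maps K n V W"
proof -
  interpret module K V by fact
  have "linear_map K V W (\<lambda>x. restrict F {vs. length vs = n \<and> set vs \<subseteq> carrier V} (vs[i := x])) \<longleftrightarrow>
      linear_map K V W (\<lambda>x. F (vs[i := x]))"
    if "length vs = n" "set vs \<subseteq> carrier V" "i < n" for vs i
    using that by (intro linear_map_cong) (auto simp: set_list_update_subsetI intro: module_axioms)
  then show ?thesis
    using F by (auto simp: multilinear_maps_iff multilinear_on_def)
qed

text \<open>Separating the head from the tail makes induction on the number of arguments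
  possible.\<close>

lemma multilinear_on_Suc:
  assumes "module K V"
  shows "multilinear_on K (Suc n) V W F \<longleftrightarrow>
    (\<forall>x \<in> carrier V. multilinear_on K n V W (\<lambda>vs. F (x # vs))) \<and>
    (\<forall>vs. length vs = n \<and> set vs \<subseteq> carrier V \<longrightarrow> linear_map K V W (\<lambda>x. F (x # vs)))"
    (is "?L \<longleftrightarrow> ?R")
proof
  interpret module K V by fact
  assume L: ?L
  show ?R
  proof (intro conjI ballI allI impI)
    fix x assume x: "x \<in> carrier V"
    show "multilinear_on K n V W (\<lambda>vs. F (x # vs))"
      unfolding multilinear_on_def
    proof (intro allI impI conjI)
      fix vs assume vs: "length vs = n \<and> set vs \<subseteq> carrier V"
      with x L show "F (x # vs) \<in> carrier W"
        by (auto simp: multilinear_on_def)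
      fix i assume "i < n"
      with vs x multilinear_onD(2)[OF L, of "x # vs" "Suc i"]
      show "linear_map K V W (\<lambda>y. F (x # vs[i := y]))" by simp
    qed
  next
    fix vs assume "length vs = n \<and> set vs \<subseteq> carrier V"
    \<comment> \<open>The zero vector is a placeholder: position \<open>0\<close> is overwritten at
      once.\<close>
    with multilinear_onD(2)[OF L, of "\<zero>\<^bsub>V\<^esub> # vs" 0]
    show "linear_map K V W (\<lambda>x. F (x # vs))" by simp
  qed
next
  assume R: ?R
  show ?L
    unfolding multilinear_on_def
  proof (intro allI impI)
    fix vs assume "length vs = Suc n \<and> set vs \<subseteq> carrier V"
    then obtain x xs where vs: "vs = x # xs" "x \<in> carrier V" "length xs = n" "set xs \<subseteq> carrier V"
      by (cases vs) auto
    have "linear_map K V W (\<lambda>y. F (vs[i := y]))" if "i < Suc n" for i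
      using R vs that by (cases i) (auto simp: multilinear_on_def)
    with R vs show "F vs \<in> carrier W \<and> (\<forall>i < Suc n. linear_map K V W (\<lambda>y. F (vs[i := y])))"
      by (auto simp: multilinear_on_def)
  qed
qed

lemma multilinear_on_plus:
  assumes "module K V" and "module K W" and "multilinear_on K n V W F" and "multilinear_on K n V W G"
  shows "multilinear_on K n V W (\<lambda>vs. F vs \<oplus>\<^bsub>W\<^esub> G vs)"
proof -
  interpret W: module K W by fact
  show ?thesis
    using assms(3,4) linear_map_plus[OF assms(1,2)] by (simp add: multilinear_on_def)
qed

lemma multilinear_on_scale:
  assumes "module K V" and "module K W" and "c \<in> carrier K" and "multilinear_on K n V W F"
  shows "multilinear_on K n V W (\<lambda>vs. c \<odot>\<^bsub>W\<^esub> F vs)"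
proof -
  interpret W: module K W by fact
  show ?thesis
    using assms(3,4) linear_map_scale[OF assms(1,2)] by (simp add: multilinear_on_def)
qed

text \<open>The shape of data that extends to a multilinear map on tensor products: slot
  \<open>i\<close> of both lists varies at the same time, as the two factors of the tensor in slot
  \<open>i\<close>.\<close>

definition multibilinear_on ::
  "('k, 'e) ring_scheme \<Rightarrow> nat \<Rightarrow> ('k, 'u) module \<Rightarrow> ('k, 'v) module \<Rightarrow> ('k, 'w) module
    \<Rightarrow> ('u list \<Rightarrow> 'v list \<Rightarrow> 'w) \<Rightarrow> bool" where
  "multibilinear_on K n U V W g \<longleftrightarrow>
    (\<forall>us vs. length us = n \<and> set us \<subseteq> carrier U \<and> length vs = n \<and> set vs \<subseteq> carrier V \<longrightarrow>
      g us vs \<in> carrier W \<and>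
      (\<forall>i < n. bilinear_map K U V W (\<lambda>u v. g (us[i := u]) (vs[i := v]))))"

lemma multibilinear_on_SucD:
  assumes "module K U" and "module K V" and g: "multibilinear_on K (Suc n) U V W g"
  shows "u \<in> carrier U \<Longrightarrow> v \<in> carrier V \<Longrightarrow> multibilinear_on K n U V W (\<lambda>us vs. g (u # us) (v # vs))"
    and "length us = n \<Longrightarrow> set us \<subseteq> carrier U \<Longrightarrow> length vs = n \<Longrightarrow> set vs \<subseteq> carrier V \<Longrightarrow>
      bilinear_map K U V W (\<lambda>u v. g (u # us) (v # vs))"
proof -
  interpret U: module K U by fact
  interpret V: module K V by fact
  note D = g[unfolded multibilinear_on_def, rule_format]
  show "multibilinear_on K n U V W (\<lambda>us vs. g (u # us) (v # vs))" if uv: "u \<in> carrier U" "v \<in> carrier V"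
    unfolding multibilinear_on_def
  proof (intro allI impI conjI)
    fix us vs
    assume a: "length us = n \<and> set us \<subseteq> carrier U \<and> length vs = n \<and> set vs \<subseteq> carrier V"
    with uv D[of "u # us" "v # vs"] show "g (u # us) (v # vs) \<in> carrier W" by auto
    fix i assume "i < n"
    with a uv D[of "u # us" "v # vs"]
    have "bilinear_map K U V W (\<lambda>x y. g ((u # us)[Suc i := x]) ((v # vs)[Suc i := y]))"
      by (intro conjunct2[OF D, rule_format]) auto
    then show "bilinear_map K U V W (\<lambda>x y. g (u # us[i := x]) (v # vs[i := y]))" by simp
  qed
  show "bilinear_map K U V W (\<lambda>u v. g (u # us) (v # vs))"
    if "length us = n" "set us \<subseteq> carrier U" "length vs = n" "set vs \<subseteq> carrier V"
  proof -
    have "bilinear_map K U V W (\<lambda>x y. g ((\<zero>\<^bsub>U\<^esub> # us)[0 := x]) ((\<zero>\<^bsub>V\<^esub> # vs)[0 := y]))"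
      using that by (intro conjunct2[OF D, rule_format]) auto
    then show ?thesis by simp
  qed
qed

context
  fixes K :: "('k, 'e) ring_scheme" and U :: "('k, 'u) module" and V :: "('k, 'v) module"
    and W :: "('k, 'w) module"
  assumes U: "module K U" and V: "module K V" and W: "module K W"
begin

interpretation U: module K U by (rule U)
interpretation V: module K V by (rule V)
interpretation W: module K W by (rule W)

private abbreviation (input) "T \<equiv> tensor_product K U V"
private abbreviation (input) "pt \<equiv> pure_tensor K U V"

interpretation T: module K T by (rule module_tensor_product[OF U V])

private lemma pt_closed: "u \<in> carrier U \<Longrightarrow> v \<in> carrier V \<Longrightarrow> pt u v \<in> carrier T"
  using bilinear_map_pure_tensor[OF U V] by (simp add: bilinear_map_def)

private lemma map2_pt_closed:
  assumes "set us \<subseteq> carrier U" and "set vs \<subseteq> carrier V"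
  shows "set (map2 pt us vs) \<subseteq> carrier T"
proof
  fix t assume "t \<in> set (map2 pt us vs)"
  then obtain u v where "t = pt u v" "(u, v) \<in> set (zip us vs)" by auto
  with assms set_zip_leftD[of u v us vs] set_zip_rightD[of u v us vs] pt_closed[of u v]
  show "t \<in> carrier T" by auto
qed

text \<open>For a pure head the induction hypothesis settles an arbitrary tail; linearity in the
  head then passes from pure tensors to all heads.\<close>

lemma multilinear_on_tensor_ext:
  assumes "multilinear_on K n T W F" and "multilinear_on K n T W G"
    and "\<And>us vs. length us = n \<Longrightarrow> set us \<subseteq> carrier U \<Longrightarrow> length vs = n \<Longrightarrow> set vs \<subseteq> carrier V \<Longrightarrow>
      F (map2 pt us vs) = G (map2 pt us vs)"
    and "length ts = n" and "set ts \<subseteq> carrier T"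
  shows "F ts = G ts"
  using assms
proof (induct n arbitrary: F G ts)
  case 0
  from "0.prems"(3)[of "[]" "[]"] "0.prems"(4) show ?case by simp
next
  case (Suc n)
  note FG = Suc.prems(1,2)[unfolded multilinear_on_Suc[OF T.module_axioms]]
  obtain t ts' where ts: "ts = t # ts'" "length ts' = n" "set ts' \<subseteq> carrier T" "t \<in> carrier T"
    using Suc.prems(4,5) by (cases ts) auto
  have pure: "F (pt u v # ts') = G (pt u v # ts')" if uv: "u \<in> carrier U" "v \<in> carrier V" for u v
  proof (rule Suc.hyps[where F = "\<lambda>ts. F (pt u v # ts)" and G = "\<lambda>ts. G (pt u v # ts)"])
    fix us vs
    assume "length us = n" "set us \<subseteq> carrier U" "length vs = n" "set vs \<subseteq> carrier V"
    with uv Suc.prems(3)[of "u # us" "v # vs"]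
    show "F (pt u v # map2 pt us vs) = G (pt u v # map2 pt us vs)" by simp
  qed (use FG pt_closed[OF uv] ts in auto)
  have "F (t # ts') = G (t # ts')"
    by (rule tensor_product_ext[OF U V W, where g = "\<lambda>t. F (t # ts')" and h = "\<lambda>t. G (t # ts')"])
      (use FG ts in \<open>simp_all add: pure\<close>)
  with ts show ?case by simp
qed

lemma multilinear_on_tensor_lift:
  assumes "multibilinear_on K n U V W g"
  shows "\<exists>F. multilinear_on K n T W F \<and>
    (\<forall>us vs. length us = n \<and> set us \<subseteq> carrier U \<and> length vs = n \<and> set vs \<subseteq> carrier V \<longrightarrow>
      F (map2 pt us vs) = g us vs)"
  using assms
proof (induct n arbitrary: g)
  case 0
  then show ?case
    by (intro exI[of _ "\<lambda>_. g [] []"]) (simp add: multilinear_on_def multibilinear_on_def)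
next
  case (Suc n)
  note g = multibilinear_on_SucD[OF U V Suc.prems]
  let ?P = "\<lambda>u v F. multilinear_on K n T W F \<and>
      (\<forall>us vs. length us = n \<and> set us \<subseteq> carrier U \<and> length vs = n \<and> set vs \<subseteq> carrier V \<longrightarrow>
        F (map2 pt us vs) = g (u # us) (v # vs))"
  \<comment> \<open>\<open>G u v\<close> extends the data in the remaining \<open>n\<close>
    arguments with the first pair frozen. It is chosen separately for each \<open>u\<close> and
    \<open>v\<close>, so no relation between different pairs is known yet.\<close>
  define G where "G u v = (SOME F. ?P u v F)" for u v
  have PG: "?P u v (G u v)" if "u \<in> carrier U" "v \<in> carrier V" for u v
    unfolding G_def using Suc.hyps[OF g(1)[OF that]] by (rule someI_ex)
  have G: "multilinear_on K n T W (G u v)" if "u \<in> carrier U" "v \<in> carrier V" for u v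
    using PG[OF that] by (rule conjunct1)
  have G_pt: "G u v (map2 pt us vs) = g (u # us) (v # vs)"
    if "u \<in> carrier U" "v \<in> carrier V" "length us = n" "set us \<subseteq> carrier U" "length vs = n" "set vs \<subseteq> carrier V"
    for u v us vs
    using conjunct2[OF PG[OF that(1,2)]] that(3-) by simp
  have G_closed: "G u v ts \<in> carrier W"
    if "u \<in> carrier U" "v \<in> carrier V" "length ts = n" "set ts \<subseteq> carrier T" for u v ts
    using G that by (simp add: multilinear_on_def)
  \<comment> \<open>Uniqueness makes the choices coherent: both sides of each identity are
    multilinear in \<open>ts\<close> and agree on tuples of pure tensors, where \<open>G\<close> is
    given by \<open>g\<close>.\<close>
  have bil: "bilinear_map K U V W (\<lambda>u v. G u v ts)" if ts: "length ts = n" "set ts \<subseteq> carrier T" for ts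
    unfolding bilinear_map_def
  proof (intro conjI ballI)
    fix u v assume u: "u \<in> carrier U" and v: "v \<in> carrier V"
    show "G u v ts \<in> carrier W" by (rule G_closed[OF u v ts])
    fix u' assume u': "u' \<in> carrier U"
    show "G (u \<oplus>\<^bsub>U\<^esub> u') v ts = G u v ts \<oplus>\<^bsub>W\<^esub> G u' v ts"
      by (rule multilinear_on_tensor_ext[OF G multilinear_on_plus[OF T.module_axioms W G G] _ ts])
        (use u u' v g(2) in \<open>simp_all add: G_pt bilinear_map_def\<close>)
  next
    fix u v v' assume u: "u \<in> carrier U" and v: "v \<in> carrier V" "v' \<in> carrier V"
    show "G u (v \<oplus>\<^bsub>V\<^esub> v') ts = G u v ts \<oplus>\<^bsub>W\<^esub> G u v' ts"
      by (rule multilinear_on_tensor_ext[OF G multilinear_on_plus[OF T.module_axioms W G G] _ ts])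
        (use u v g(2) in \<open>simp_all add: G_pt bilinear_map_def\<close>)
  next
    fix c u v assume c: "c \<in> carrier K" and u: "u \<in> carrier U" and v: "v \<in> carrier V"
    show "G (c \<odot>\<^bsub>U\<^esub> u) v ts = c \<odot>\<^bsub>W\<^esub> G u v ts"
      by (rule multilinear_on_tensor_ext[OF G multilinear_on_scale[OF T.module_axioms W c G] _ ts])
        (use c u v g(2) in \<open>simp_all add: G_pt bilinear_map_def\<close>)
    show "G u (c \<odot>\<^bsub>V\<^esub> v) ts = c \<odot>\<^bsub>W\<^esub> G u v ts"
      by (rule multilinear_on_tensor_ext[OF G multilinear_on_scale[OF T.module_axioms W c G] _ ts])
        (use c u v g(2) in \<open>simp_all add: G_pt bilinear_map_def\<close>)
  qed
  let ?Q = "\<lambda>ts h. linear_map K T W h \<and>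
      (\<forall>u \<in> carrier U. \<forall>v \<in> carrier V. h (pt u v) = G u v ts)"
  \<comment> \<open>\<open>H ts\<close> is linear in the head by construction; linearity in the
    entries of \<open>ts\<close> remains to be shown.\<close>
  define H where "H ts = (SOME h. ?Q ts h)" for ts
  have QH: "?Q ts (H ts)" if ts: "length ts = n" "set ts \<subseteq> carrier T" for ts
  proof -
    have "\<exists>h. ?Q ts h"
      using tensor_product_lift[OF U V W bil[OF ts]] by simp
    then show ?thesis
      unfolding H_def by (rule someI_ex)
  qed
  have H: "linear_map K T W (H ts)" if "length ts = n" "set ts \<subseteq> carrier T" for ts
    using QH[OF that] by (rule conjunct1)
  have H_pt: "H ts (pt u v) = G u v ts"
    if "length ts = n" "set ts \<subseteq> carrier T" "u \<in> carrier U" "v \<in> carrier V" for ts u v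
    using conjunct2[OF QH[OF that(1,2)]] that(3-) by simp
  \<comment> \<open>Linearity in the tail is tested on a pure head, where \<open>H\<close> reduces
    to the multilinear \<open>G u v\<close>, and carried over to every head \<open>t\<close> by
    \<open>tensor_product_ext\<close>.\<close>
  have "multilinear_on K n T W (\<lambda>ts. H ts t)" if t: "t \<in> carrier T" for t
    unfolding multilinear_on_def
  proof (intro allI impI conjI)
    fix ts assume ts: "length ts = n \<and> set ts \<subseteq> carrier T"
    show "H ts t \<in> carrier W"
      by (rule linear_map_closed[OF H t]) (use ts in simp_all)
    fix i assume i: "i < n"
    have upd: "length (ts[i := x]) = n" "set (ts[i := x]) \<subseteq> carrier T" if "x \<in> carrier T" for x
      using ts that by (auto simp: set_list_update_subsetI)
    have lin: "linear_map K T W (\<lambda>x. G u v (ts[i := x]))" if "u \<in> carrier U" "v \<in> carrier V" for u v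
      using G[OF that] ts i by (simp add: multilinear_on_def)
    show "linear_map K T W (\<lambda>x. H (ts[i := x]) t)"
    proof (rule linear_mapI)
      fix x assume x: "x \<in> carrier T"
      show "H (ts[i := x]) t \<in> carrier W"
        using linear_map_closed[OF H[OF upd[OF x]] t] .
      fix y assume y: "y \<in> carrier T"
      have xy: "x \<oplus>\<^bsub>T\<^esub> y \<in> carrier T" using x y by simp
      show "H (ts[i := x \<oplus>\<^bsub>T\<^esub> y]) t = H (ts[i := x]) t \<oplus>\<^bsub>W\<^esub> H (ts[i := y]) t"
        by (rule tensor_product_ext[OF U V W H[OF upd[OF xy]]
            linear_map_plus[OF T.module_axioms W H[OF upd[OF x]] H[OF upd[OF y]]] _ t])
          (use ts x y in \<open>simp add: H_pt upd(2) linear_map_add[OF lin]\<close>)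
    next
      fix c x assume c: "c \<in> carrier K" and x: "x \<in> carrier T"
      have cx: "c \<odot>\<^bsub>T\<^esub> x \<in> carrier T" using c x by simp
      show "H (ts[i := c \<odot>\<^bsub>T\<^esub> x]) t = c \<odot>\<^bsub>W\<^esub> H (ts[i := x]) t"
        by (rule tensor_product_ext[OF U V W H[OF upd[OF cx]]
            linear_map_scale[OF T.module_axioms W c H[OF upd[OF x]]] _ t])
          (use ts c x in \<open>simp add: H_pt upd(2) linear_map_smult[OF lin]\<close>)
    qed
  qed
  then have "multilinear_on K (Suc n) T W (\<lambda>ts. H (tl ts) (hd ts))"
    using H by (simp add: multilinear_on_Suc[OF T.module_axioms])
  moreover have "H (tl (map2 pt us vs)) (hd (map2 pt us vs)) = g us vs"
    if "length us = Suc n" "set us \<subseteq> carrier U" "length vs = Suc n" "set vs \<subseteq> carrier V" for us vs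
  proof -
    obtain u us' v vs' where "us = u # us'" "vs = v # vs'"
      using \<open>length us = Suc n\<close> \<open>length vs = Suc n\<close> by (cases us; cases vs) auto
    moreover from this have "set (map2 pt us' vs') \<subseteq> carrier T"
      using that by (intro map2_pt_closed) simp_all
    ultimately show ?thesis
      using that by (simp add: H_pt G_pt)
  qed
  ultimately show ?case
    by (intro exI[of _ "\<lambda>ts. H (tl ts) (hd ts)"]) blast
qed

end

subsection \<open>\<open>\<Psi>\<close> is well defined\<close>

lemma bilinear_map_compose:
  assumes "linear_map K U' U g" and "linear_map K V' V h" and "bilinear_map K U V W f"
  shows "bilinear_map K U' V' W (\<lambda>u v. f (g u) (h v))"
  using assms by (simp add: bilinear_map_def linear_map_def)

lemma bilinear_map_plus:
  assumes "module K U" and "module K V" and "module K W"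
    and "bilinear_map K U V W f" and "bilinear_map K U V W g"
  shows "bilinear_map K U V W (\<lambda>u v. f u v \<oplus>\<^bsub>W\<^esub> g u v)"
  using assms by (simp add: bilinear_map_iff linear_map_plus)

lemma bilinear_map_scale:
  assumes "module K U" and "module K V" and "module K W" and "c \<in> carrier K"
    and "bilinear_map K U V W f"
  shows "bilinear_map K U V W (\<lambda>u v. c \<odot>\<^bsub>W\<^esub> f u v)"
  using assms by (simp add: bilinear_map_iff linear_map_scale)

context
  fixes K :: "('k, 'e) ring_scheme" and U :: "('k, 'u) module" and V :: "('k, 'v) module"
    and W :: "('k, 'w) module"
  assumes U: "module K U" and V: "module K V" and W: "module K W"
begin

interpretation W: module K W by (rule W)

lemma multibilinear_on_plus:
  assumes "multibilinear_on K n U V W f" and "multibilinear_on K n U V W g"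
  shows "multibilinear_on K n U V W (\<lambda>us vs. f us vs \<oplus>\<^bsub>W\<^esub> g us vs)"
  using assms by (simp add: multibilinear_on_def bilinear_map_plus[OF U V W])

lemma multibilinear_on_scale:
  assumes "c \<in> carrier K" and "multibilinear_on K n U V W f"
  shows "multibilinear_on K n U V W (\<lambda>us vs. c \<odot>\<^bsub>W\<^esub> f us vs)"
  using assms by (simp add: multibilinear_on_def bilinear_map_scale[OF U V W])

text \<open>Only tuples of length \<open>n\<close> over the carriers matter, so a formula may be
  replaced by one that is equal to it merely there.\<close>

lemma multibilinear_on_cong:
  assumes "\<And>us vs. length us = n \<Longrightarrow> set us \<subseteq> carrier U \<Longrightarrow> length vs = n \<Longrightarrow> set vs \<subseteq> carrier V \<Longrightarrow>
      f us vs = g us vs"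
    and g: "multibilinear_on K n U V W g"
  shows "multibilinear_on K n U V W f"
  unfolding multibilinear_on_def
proof (intro allI impI conjI)
  interpret U: module K U by (rule U)
  interpret V: module K V by (rule V)
  fix us vs assume a: "length us = n \<and> set us \<subseteq> carrier U \<and> length vs = n \<and> set vs \<subseteq> carrier V"
  with assms show "f us vs \<in> carrier W" by (simp add: multibilinear_on_def)
  fix i assume i: "i < n"
  have eq: "f (us[i := u]) (vs[i := v]) = g (us[i := u]) (vs[i := v])"
    if "u \<in> carrier U" "v \<in> carrier V" for u v
    using a that by (intro assms(1)) (simp_all add: set_list_update_subsetI)
  have "bilinear_map K U V W (\<lambda>u v. g (us[i := u]) (vs[i := v]))"
    using g a i by (simp add: multibilinear_on_def)
  then show "bilinear_map K U V W (\<lambda>u v. f (us[i := u]) (vs[i := v]))"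
    by (simp add: bilinear_map_def eq)
qed

lemma multibilinear_on_minus:
  assumes f: "multibilinear_on K n U V W f" and g: "multibilinear_on K n U V W g"
  shows "multibilinear_on K n U V W (\<lambda>us vs. f us vs \<ominus>\<^bsub>W\<^esub> g us vs)"
proof (rule multibilinear_on_cong)
  show "multibilinear_on K n U V W (\<lambda>us vs. f us vs \<oplus>\<^bsub>W\<^esub> (\<ominus>\<^bsub>K\<^esub> \<one>\<^bsub>K\<^esub>) \<odot>\<^bsub>W\<^esub> g us vs)"
    by (intro multibilinear_on_plus multibilinear_on_scale f g) simp
qed (use g in \<open>simp add: a_minus_def W.smult_l_minus multibilinear_on_def\<close>)

lemma multibilinear_on_finsum:
  assumes "finite I" and "\<And>i. i \<in> I \<Longrightarrow> multibilinear_on K n U V W (f i)"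
  shows "multibilinear_on K n U V W (\<lambda>us vs. \<Oplus>\<^bsub>W\<^esub> i \<in> I. f i us vs)"
  using assms
proof (induct I)
  case empty
  show ?case by (simp add: multibilinear_on_def bilinear_map_def)
next
  case (insert i I)
  show ?case
  proof (rule multibilinear_on_cong)
    show "multibilinear_on K n U V W (\<lambda>us vs. f i us vs \<oplus>\<^bsub>W\<^esub> (\<Oplus>\<^bsub>W\<^esub> i \<in> I. f i us vs))"
      by (rule multibilinear_on_plus) (use insert in simp_all)
    fix us vs
    assume "length us = n" "set us \<subseteq> carrier U" "length vs = n" "set vs \<subseteq> carrier V"
    then have "f j us vs \<in> carrier W" if "j \<in> insert i I" for j
      using insert.prems[OF that] by (simp add: multibilinear_on_def)
    then show "(\<Oplus>\<^bsub>W\<^esub> j \<in> insert i I. f j us vs) = f i us vs \<oplus>\<^bsub>W\<^esub> (\<Oplus>\<^bsub>W\<^esub> i \<in> I. f i us vs)"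
      using insert.hyps by (simp add: Pi_iff)
  qed
qed

end

text \<open>Every entry of the argument reappears at one position that depends only on \<open>n\<close>, so composition
  with a rearrangement preserves multilinearity.\<close>

definition rearrangement :: "nat \<Rightarrow> ('a list \<Rightarrow> 'a list) \<Rightarrow> bool" where
  "rearrangement n R \<longleftrightarrow>
    (\<forall>xs. length xs = n \<longrightarrow> length (R xs) = n \<and> set (R xs) \<subseteq> set xs) \<and>
    (\<forall>i < n. \<exists>j < n. \<forall>xs x. length xs = n \<longrightarrow> R (xs[i := x]) = (R xs)[j := x])"

lemma rearrangement_id: "rearrangement n (\<lambda>xs. xs)"
  by (auto simp: rearrangement_def)

lemma rearrangement_rev: "rearrangement n rev"
  unfolding rearrangement_def
proof (intro conjI allI impI)
  fix i assume "i < n"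
  then show "\<exists>j < n. \<forall>xs x. length xs = n \<longrightarrow> rev (xs[i := x]) = (rev xs)[j := x]"
    by (intro exI[of _ "n - Suc i"]) (auto simp: rev_update)
qed auto

lemma rearrangement_rev_prefix: "rearrangement n (\<lambda>xs. rev (take k xs) @ drop k xs)"
  unfolding rearrangement_def
proof (intro conjI allI impI)
  fix i assume i: "i < n"
  show "\<exists>j < n. \<forall>xs x. length xs = n \<longrightarrow>
      rev (take k (xs[i := x])) @ drop k (xs[i := x]) = (rev (take k xs) @ drop k xs)[j := x]"
  proof (cases "i < k")
    case True
    \<comment> \<open>The reversed prefix has length \<open>min n k\<close>, which is less than
      \<open>k\<close> when the list ends early.\<close>
    with i show ?thesis
      by (intro exI[of _ "min n k - Suc i"])
        (auto simp: take_update_swap rev_update list_update_append min_def)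
  next
    case False
    with i show ?thesis
      by (intro exI[of _ i])
        (auto simp: drop_update_swap list_update_append min_def)
  qed
qed (auto dest: in_set_takeD in_set_dropD)

lemma rearrangement_swap:
  assumes "Suc k < n"
  shows "rearrangement n (\<lambda>xs. xs[k := xs ! Suc k, Suc k := xs ! k])"
  unfolding rearrangement_def
proof (intro conjI allI impI)
  fix xs :: "'a list" assume "length xs = n"
  with assms show "set (xs[k := xs ! Suc k, Suc k := xs ! k]) \<subseteq> set xs"
    by (intro set_list_update_subsetI) auto
next
  fix i assume "i < n"
  \<comment> \<open>The new position of slot \<open>i\<close> under the transposition of
    \<open>k\<close> and \<open>Suc k\<close>.\<close>
  let ?j = "if i = k then Suc k else if i = Suc k then k else i"
  have eq: "xs[i := x, k := xs[i := x] ! Suc k, Suc k := xs[i := x] ! k] =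
      xs[k := xs ! Suc k, Suc k := xs ! k, ?j := x]" if "length xs = n" for xs :: "'a list" and x
    using that assms by (intro nth_equalityI) (auto simp: nth_list_update)
  show "\<exists>j < n. \<forall>xs x. length (xs :: 'a list) = n \<longrightarrow>
      xs[i := x, k := xs[i := x] ! Suc k, Suc k := xs[i := x] ! k] =
      xs[k := xs ! Suc k, Suc k := xs ! k, j := x]"
  proof (intro exI[of _ ?j] conjI allI impI)
    show "?j < n" using \<open>i < n\<close> assms by simp
  qed (rule eq)
qed simp

text \<open>Connects the slices by which \<open>Psi_value\<close> exchanges two neighbouring entries
  of \<open>bs\<close> with the updates treated in \<open>rearrangement_swap\<close>.\<close>

lemma swap_adjacent:
  assumes "Suc k < length xs"
  shows "take k xs @ xs ! Suc k # xs ! k # drop (Suc (Suc k)) xs = xs[k := xs ! Suc k, Suc k := xs ! k]"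
  using assms by (intro nth_equalityI) (auto simp: nth_append nth_list_update nth_Cons' Suc_diff_Suc numeral_2_eq_2)

text \<open>\<open>foldl\<close> nests to the left: an entry comes in once as a right factor and
  then travels inside the accumulator, on which all further multiplications act linearly.\<close>

lemma foldl_mult_linear:
  assumes A: "nonassoc_algebra K A" and xs: "set xs \<subseteq> carrier A"
  shows "linear_map K A A (\<lambda>a. foldl (mult A) a xs)"
    and "a \<in> carrier A \<Longrightarrow> i < length xs \<Longrightarrow> linear_map K A A (\<lambda>x. foldl (mult A) a (xs[i := x]))"
proof -
  have mult: "bilinear_map K A A A (mult A)"
    using A by (simp add: nonassoc_algebra_def)
  have *: "linear_map K A A (\<lambda>a. foldl (mult A) a ys)" if "set ys \<subseteq> carrier A" for ys
    using that
  proof (induct ys)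
    case Nil
    show ?case by (simp add: linear_map_def)
  next
    case (Cons y ys)
    have "linear_map K A A (\<lambda>a. a \<otimes>\<^bsub>A\<^esub> y)"
      using mult Cons.prems by (simp add: bilinear_map_iff)
    from linear_map_compose[OF this Cons.hyps] Cons.prems show ?case by simp
  qed
  then show "linear_map K A A (\<lambda>a. foldl (mult A) a xs)" using xs .
  show "linear_map K A A (\<lambda>x. foldl (mult A) a (xs[i := x]))" if "a \<in> carrier A" "i < length xs"
    using that xs
  proof (induct xs arbitrary: a i)
    case (Cons y ys)
    have l: "linear_map K A A (\<lambda>x. a \<otimes>\<^bsub>A\<^esub> x)"
      using mult Cons.prems by (simp add: bilinear_map_iff)
    show ?case
    proof (cases i)
      case 0
      from linear_map_compose[OF l *[of ys]] Cons.prems 0 show ?thesis by simp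
    next
      case (Suc j)
      with Cons.hyps[of "a \<otimes>\<^bsub>A\<^esub> y" j] Cons.prems linear_map_closed[OF l, of y] show ?thesis by simp
    qed
  qed simp
qed

text \<open>The bound on \<open>n\<close> reflects that \<open>list_product\<close> starts from
  \<open>hd\<close>, which is unspecified on the empty list.\<close>

lemma multilinear_on_list_product:
  assumes A: "nonassoc_algebra K A" and n: "n \<ge> 1"
  shows "multilinear_on K n A A (list_product A)"
proof -
  have A': "module K A"
    using A by (simp add: nonassoc_algebra_def)
  obtain m where m: "n = Suc m" using n by (cases n) auto
  have "multilinear_on K m A A (foldl (mult A) x)" if "x \<in> carrier A" for x
    unfolding multilinear_on_def
  proof (intro allI impI conjI)
    fix xs assume xs: "length xs = m \<and> set xs \<subseteq> carrier A"
    then have "set xs \<subseteq> carrier A" ..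
    note l = foldl_mult_linear[OF A this]
    show "foldl (mult A) x xs \<in> carrier A" by (rule linear_map_closed[OF l(1) that])
    show "linear_map K A A (\<lambda>y. foldl (mult A) x (xs[i := y]))" if "i < m" for i
      using l(2)[OF \<open>x \<in> carrier A\<close>] that xs by simp
  qed
  then show ?thesis
    unfolding m multilinear_on_Suc[OF A'] list_product_def
    using foldl_mult_linear(1)[OF A] by simp
qed

text \<open>Slot \<open>i\<close> may move to different positions \<open>j\<close> and
  \<open>k\<close> in the two factors. The middle terms of \<open>Psi_value\<close> require this: a
  whole prefix of the word is reversed, whereas only two entries of \<open>bs\<close> change
  places.\<close>

lemma multibilinear_on_pure_tensor:
  assumes U: "module K U" and V: "module K V"
    and g: "multilinear_on K n U' U g" and f: "multilinear_on K n V' V f"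
    and R: "rearrangement n R" and S: "rearrangement n S"
  shows "multibilinear_on K n U' V' (tensor_product K U V) (\<lambda>us vs. pure_tensor K U V (g (R us)) (f (S vs)))"
  unfolding multibilinear_on_def
proof (intro allI impI conjI)
  fix us vs
  assume a: "length us = n \<and> set us \<subseteq> carrier U' \<and> length vs = n \<and> set vs \<subseteq> carrier V'"
  then have RS: "length (R us) = n" "set (R us) \<subseteq> carrier U'" "length (S vs) = n" "set (S vs) \<subseteq> carrier V'"
    using R S unfolding rearrangement_def by blast+
  note pt = bilinear_map_pure_tensor[OF U V]
  show "pure_tensor K U V (g (R us)) (f (S vs)) \<in> carrier (tensor_product K U V)"
    using pt multilinear_onD(1)[OF g RS(1,2)] multilinear_onD(1)[OF f RS(3,4)]
    by (simp add: bilinear_map_def)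
  fix i assume "i < n"
  then have "\<exists>j < n. \<forall>xs x. length xs = n \<longrightarrow> R (xs[i := x]) = (R xs)[j := x]"
    and "\<exists>k < n. \<forall>xs x. length xs = n \<longrightarrow> S (xs[i := x]) = (S xs)[k := x]"
    using R S by (simp_all add: rearrangement_def)
  then obtain j k where "j < n" "k < n" "\<And>u. R (us[i := u]) = (R us)[j := u]" "\<And>v. S (vs[i := v]) = (S vs)[k := v]"
    using a by auto
  then show "bilinear_map K U' V' (tensor_product K U V)
      (\<lambda>u v. pure_tensor K U V (g (R (us[i := u]))) (f (S (vs[i := v]))))"
    using bilinear_map_compose[OF multilinear_onD(2)[OF g RS(1,2)] multilinear_onD(2)[OF f RS(3,4)] pt]
    by simp
qed

section \<open>Extension of the formula for \<open>Psi\<close> from pure tensors\<close>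

context
  fixes K :: "('k, 'e) ring_scheme" and A :: "('k, 'a) module" and P :: "('k, 'p) module"
    and N :: "('k, 'n) module" and n :: nat and f :: "'p list \<Rightarrow> 'n"
  assumes A: "nonassoc_algebra K A" and P: "module K P" and N: "module K N"
    and n: "n \<ge> 1" and f: "f \<in> C_Pre K P N n"
begin

private lemma A': "module K A"
  using A by (simp add: nonassoc_algebra_def)

private lemma f': "multilinear_on K n P N f"
  using f by (simp add: C_Pre_def multilinear_maps_iff)

interpretation A: module K A by (rule A')
interpretation T: module K "tensor_product K A N" by (rule module_tensor_product[OF A' N])

lemma multibilinear_on_Psi_value:
  "multibilinear_on K n A P (tensor_product K A N) (Psi_value K A P N n f)"
proof -
  let ?T = "tensor_product K A N"
  let ?mb = "multibilinear_on K n A P ?T"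
  let ?term = "\<lambda>as bs. pure_tensor K A N (list_product A as) (f bs)"
  have rearr: "?mb (\<lambda>as bs. ?term (R as) (S bs))" if "rearrangement n R" "rearrangement n S" for R S
    by (rule multibilinear_on_pure_tensor[OF A' N multilinear_on_list_product[OF A n] f' that])
  have sign: "(\<ominus>\<^bsub>K\<^esub> \<one>\<^bsub>K\<^esub>) [^]\<^bsub>K\<^esub> i \<in> carrier K" for i :: nat
    by (intro A.R.nat_pow_closed) simp
  have first: "?mb ?term"
    using rearr[OF rearrangement_id rearrangement_id] .
  have second: "?mb (\<lambda>as bs. ?term (as[0 := as ! 1, 1 := as ! 0]) (bs[0 := bs ! 1, 1 := bs ! 0]))"
    if "n > 1"
    using rearr[OF rearrangement_swap rearrangement_swap, of 0 0] that by simp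
  have middle: "?mb (\<lambda>as bs. \<Oplus>\<^bsub>?T\<^esub> i \<in> {2..n - 2}. (\<ominus>\<^bsub>K\<^esub> \<one>\<^bsub>K\<^esub>) [^]\<^bsub>K\<^esub> i \<odot>\<^bsub>?T\<^esub>
      ?term (rev (take (i + 1) as) @ drop (i + 1) as)
        (take (i - 1) bs @ [bs ! i, bs ! (i - 1)] @ drop (i + 1) bs))"
  proof (rule multibilinear_on_finsum[OF A' P T.module_axioms])
    fix i assume i: "i \<in> {2..n - 2}"
    \<comment> \<open>\<open>k\<close> is the zero-based position of \<open>b\<^sub>i\<close>, so
      the exchange of the entries at \<open>i - 1\<close> and \<open>i\<close> is the swap at
      \<open>k\<close>.\<close>
    then obtain k where k: "i = Suc k" by (cases i) auto
    then have "Suc k < n" using i by auto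
    show "?mb (\<lambda>as bs. (\<ominus>\<^bsub>K\<^esub> \<one>\<^bsub>K\<^esub>) [^]\<^bsub>K\<^esub> i \<odot>\<^bsub>?T\<^esub>
      ?term (rev (take (i + 1) as) @ drop (i + 1) as)
        (take (i - 1) bs @ [bs ! i, bs ! (i - 1)] @ drop (i + 1) bs))"
    proof (intro multibilinear_on_scale[OF A' P T.module_axioms] sign,
        rule multibilinear_on_cong[OF A' P T.module_axioms])
      show "?mb (\<lambda>as bs. ?term (rev (take (i + 1) as) @ drop (i + 1) as)
          (bs[k := bs ! Suc k, Suc k := bs ! k]))"
        using i k by (intro rearr rearrangement_rev_prefix rearrangement_swap) auto
    qed (use k \<open>Suc k < n\<close> in \<open>simp add: swap_adjacent\<close>)
  qed simp
  have last: "?mb (\<lambda>as bs. (\<ominus>\<^bsub>K\<^esub> \<one>\<^bsub>K\<^esub>) [^]\<^bsub>K\<^esub> (n - 1) \<odot>\<^bsub>?T\<^esub> ?term (rev as) (rev bs))"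
    by (intro multibilinear_on_scale[OF A' P T.module_axioms] sign rearr rearrangement_rev)
  consider "n = 1" | "n = 2" | "n > 2"
    using n by linarith
  then show ?thesis
  proof cases
    case 1
    with first show ?thesis by (simp add: Psi_value_def[abs_def])
  next
    case 2
    with multibilinear_on_minus[OF A' P T.module_axioms first second]
    show ?thesis by (simp add: Psi_value_def[abs_def])
  next
    case 3
    with multibilinear_on_plus[OF A' P T.module_axioms multibilinear_on_plus[OF A' P T.module_axioms
        multibilinear_on_minus[OF A' P T.module_axioms first second] middle] last]
    show ?thesis by (simp add: Psi_value_def[abs_def] Let_def)
  qed
qed

text \<open>Discharges the definite description: existence is the lift of \<open>Psi_value\<close>;
  for uniqueness, pure tensors determine a multilinear map on tuples and extensionality determines
  it elsewhere.\<close>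

lemma Psi_spec:
  "Psi K A P N n f \<in> multilinear_maps K n (tensor_product K A P) (tensor_product K A N) \<and>
    (\<forall>as bs. length as = n \<and> set as \<subseteq> carrier A \<and> length bs = n \<and> set bs \<subseteq> carrier P \<longrightarrow>
      Psi K A P N n f (map2 (pure_tensor K A P) as bs) = Psi_value K A P N n f as bs)"
proof -
  let ?TP = "tensor_product K A P" and ?TN = "tensor_product K A N"
  let ?D = "{ts. length ts = n \<and> set ts \<subseteq> carrier ?TP}"
  interpret TP: module K ?TP by (rule module_tensor_product[OF A' P])
  have pt: "set (map2 (pure_tensor K A P) as bs) \<subseteq> carrier ?TP"
    if "set as \<subseteq> carrier A" "set bs \<subseteq> carrier P" for as bs
  proof
    fix t assume "t \<in> set (map2 (pure_tensor K A P) as bs)"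
    then obtain a b where "t = pure_tensor K A P a b" "(a, b) \<in> set (zip as bs)" by auto
    with that set_zip_leftD[of a b as bs] set_zip_rightD[of a b as bs]
      bilinear_map_pure_tensor[OF A' P]
    show "t \<in> carrier ?TP" by (auto simp: bilinear_map_def)
  qed
  obtain F where F: "multilinear_on K n ?TP ?TN F"
    and F_pt: "\<forall>as bs. length as = n \<and> set as \<subseteq> carrier A \<and> length bs = n \<and> set bs \<subseteq> carrier P \<longrightarrow>
      F (map2 (pure_tensor K A P) as bs) = Psi_value K A P N n f as bs"
    using multilinear_on_tensor_lift[OF A' P T.module_axioms multibilinear_on_Psi_value] by auto
  show ?thesis
    unfolding Psi_def
  \<comment> \<open>The lift is arbitrary off the tuples; restricting it produces the required value
    \<open>undefined\<close> there.\<close>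
  proof (rule theI[where a = "restrict F ?D"])
    show "restrict F ?D \<in> multilinear_maps K n ?TP ?TN \<and>
      (\<forall>as bs. length as = n \<and> set as \<subseteq> carrier A \<and> length bs = n \<and> set bs \<subseteq> carrier P \<longrightarrow>
        restrict F ?D (map2 (pure_tensor K A P) as bs) = Psi_value K A P N n f as bs)"
    proof (intro conjI allI impI)
      show "restrict F ?D \<in> multilinear_maps K n ?TP ?TN"
        by (rule restrict_multilinear_maps[OF TP.module_axioms F])
      fix as bs
      assume a: "length as = n \<and> set as \<subseteq> carrier A \<and> length bs = n \<and> set bs \<subseteq> carrier P"
      then have "map2 (pure_tensor K A P) as bs \<in> ?D"
        using pt by simp
      then show "restrict F ?D (map2 (pure_tensor K A P) as bs) = Psi_value K A P N n f as bs"
        using F_pt a by (simp del: mem_Collect_eq)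
    qed
    fix G
    assume G: "G \<in> multilinear_maps K n ?TP ?TN \<and>
      (\<forall>as bs. length as = n \<and> set as \<subseteq> carrier A \<and> length bs = n \<and> set bs \<subseteq> carrier P \<longrightarrow>
        G (map2 (pure_tensor K A P) as bs) = Psi_value K A P N n f as bs)"
    then have G_ext: "G \<in> extensional ?D" and G_mult: "multilinear_on K n ?TP ?TN G"
      by (simp_all add: multilinear_maps_iff)
    have "G ts = F ts" if "length ts = n" "set ts \<subseteq> carrier ?TP" for ts
    proof (rule multilinear_on_tensor_ext[OF A' P T.module_axioms G_mult F _ that])
      fix as bs
      assume "length as = n" "set as \<subseteq> carrier A" "length bs = n" "set bs \<subseteq> carrier P"
      then have a: "length as = n \<and> set as \<subseteq> carrier A \<and> length bs = n \<and> set bs \<subseteq> carrier P"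
        by simp
      show "G (map2 (pure_tensor K A P) as bs) = F (map2 (pure_tensor K A P) as bs)"
        using conjunct2[OF G, rule_format, OF a] F_pt[rule_format, OF a] by (rule trans[OF _ sym])
    qed
    with G_ext show "G = restrict F ?D"
      by (intro extensionalityI[of _ ?D]) auto
  qed
qed

end

subsection \<open>Coefficients on the free Perm algebra\<close>

text \<open>The base field as a space over itself, rebuilt as a \<open>module\<close> record so that
  a functional is an instance of \<open>linear_map\<close>.\<close>

definition ring_module :: "('k, 'e) ring_scheme \<Rightarrow> ('k, 'k) module" where
  "ring_module K = \<lparr>carrier = carrier K, mult = mult K, one = one K, zero = zero K, add = add K,
    smult = mult K\<rparr>"

lemma module_ring_module:
  assumes "cring K"
  shows "module K (ring_module K)"
proof -
  interpret cring K by fact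
  have "abelian_group (ring_module K)"
    by (rule abelian_groupI) (auto simp: ring_module_def a_ac intro: l_neg)
  then show ?thesis
    using is_cring by (intro moduleI) (auto simp: ring_module_def l_distr r_distr m_assoc)
qed

section \<open>The free associative algebra on words\<close>

context
  fixes K :: "('k, 'e) ring_scheme" and X :: "'x set"
  assumes K: "cring K"
begin

interpretation K: cring K by (rule K)

private abbreviation (input) "F \<equiv> free_assoc K X"
private abbreviation (input) "words \<equiv> {w. w \<noteq> [] \<and> set w \<subseteq> X}"

lemma free_assoc_simps:
  "carrier F = carrier (free_module K words)"
  "f \<oplus>\<^bsub>F\<^esub> g = (\<lambda>w. f w \<oplus>\<^bsub>K\<^esub> g w)"
  "c \<odot>\<^bsub>F\<^esub> f = (\<lambda>w. c \<otimes>\<^bsub>K\<^esub> f w)"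
  "\<zero>\<^bsub>F\<^esub> = (\<lambda>w. \<zero>\<^bsub>K\<^esub>)"
  "(f \<otimes>\<^bsub>F\<^esub> g) w = (\<Oplus>\<^bsub>K\<^esub> i \<in> {..length w}. f (take i w) \<otimes>\<^bsub>K\<^esub> g (drop i w))"
  by (simp_all add: free_assoc_def free_module_def)

lemma module_free_assoc: "module K F"
  by (rule module_change_mult[OF module_free_module[OF K, of words]])
    (simp_all add: free_assoc_def)

interpretation F: module K F by (rule module_free_assoc)

lemma free_assoc_value: "f \<in> carrier F \<Longrightarrow> f w \<in> carrier K"
  by (simp add: free_assoc_simps free_module_def)

lemma free_assoc_Nil: "f \<in> carrier F \<Longrightarrow> f [] = \<zero>\<^bsub>K\<^esub>"
  by (simp add: free_assoc_simps free_module_def)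

text \<open>A coefficient of a product is a sum over the cuts of \<open>w\<close> into prefix and
  suffix. The criterion serves both for the support of a product and for the ideal property of
  \<open>power_null\<close>.\<close>

lemma free_assoc_mult_eq_zero:
  assumes "f \<in> carrier F" and "g \<in> carrier F"
    and "\<And>i. i \<le> length w \<Longrightarrow> f (take i w) = \<zero>\<^bsub>K\<^esub> \<or> g (drop i w) = \<zero>\<^bsub>K\<^esub>"
  shows "(f \<otimes>\<^bsub>F\<^esub> g) w = \<zero>\<^bsub>K\<^esub>"
  unfolding free_assoc_simps(5)
proof (rule K.add.finprod_one_eqI)
  fix i assume "i \<in> {..length w}"
  with assms(3)[of i] free_assoc_value[OF assms(1)] free_assoc_value[OF assms(2)]
  show "f (take i w) \<otimes>\<^bsub>K\<^esub> g (drop i w) = \<zero>\<^bsub>K\<^esub>" by auto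
qed

lemma free_assoc_mult_closed:
  assumes f: "f \<in> carrier F" and g: "g \<in> carrier F"
  shows "f \<otimes>\<^bsub>F\<^esub> g \<in> carrier F"
proof -
  have supp: "finite {w. f w \<noteq> \<zero>\<^bsub>K\<^esub>}" "finite {w. g w \<noteq> \<zero>\<^bsub>K\<^esub>}"
    "\<And>w. w \<notin> words \<Longrightarrow> f w = \<zero>\<^bsub>K\<^esub>" "\<And>w. w \<notin> words \<Longrightarrow> g w = \<zero>\<^bsub>K\<^esub>"
    using f g by (auto simp: free_assoc_simps free_module_def)
  have "(f \<otimes>\<^bsub>F\<^esub> g) w \<in> carrier K" for w
    unfolding free_assoc_simps(5)
    by (intro K.finsum_closed) (simp add: free_assoc_value[OF f] free_assoc_value[OF g])
  moreover have "(f \<otimes>\<^bsub>F\<^esub> g) w = \<zero>\<^bsub>K\<^esub>" if w: "w \<notin> words" for w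
  proof (rule free_assoc_mult_eq_zero[OF f g])
    fix i
    have "set w = set (take i w) \<union> set (drop i w)"
      by (metis append_take_drop_id set_append)
    with w have "take i w \<notin> words \<or> drop i w \<notin> words" by auto
    with supp(3,4) show "f (take i w) = \<zero>\<^bsub>K\<^esub> \<or> g (drop i w) = \<zero>\<^bsub>K\<^esub>" by blast
  qed
  \<comment> \<open>Only concatenations of two support words can carry a coefficient, and there are
    finitely many of them.\<close>
  moreover have "{w. (f \<otimes>\<^bsub>F\<^esub> g) w \<noteq> \<zero>\<^bsub>K\<^esub>} \<subseteq>
      (\<lambda>(u, v). u @ v) ` ({w. f w \<noteq> \<zero>\<^bsub>K\<^esub>} \<times> {w. g w \<noteq> \<zero>\<^bsub>K\<^esub>})"
  proof
    fix w assume "w \<in> {w. (f \<otimes>\<^bsub>F\<^esub> g) w \<noteq> \<zero>\<^bsub>K\<^esub>}"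
    then obtain i where "f (take i w) \<noteq> \<zero>\<^bsub>K\<^esub>" "g (drop i w) \<noteq> \<zero>\<^bsub>K\<^esub>"
      using free_assoc_mult_eq_zero[OF f g, of w] by auto
    then show "w \<in> (\<lambda>(u, v). u @ v) ` ({w. f w \<noteq> \<zero>\<^bsub>K\<^esub>} \<times> {w. g w \<noteq> \<zero>\<^bsub>K\<^esub>})"
      by (intro image_eqI[of _ _ "(take i w, drop i w)"]) auto
  qed
  then have "finite {w. (f \<otimes>\<^bsub>F\<^esub> g) w \<noteq> \<zero>\<^bsub>K\<^esub>}"
    by (rule finite_subset) (simp add: supp)
  ultimately show ?thesis
    by (simp add: free_assoc_simps(1) free_module_def)
qed

lemma bilinear_map_free_assoc: "bilinear_map K F F F (mult F)"
  unfolding bilinear_map_def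
proof (intro conjI ballI)
  fix f g assume f: "f \<in> carrier F" and g: "g \<in> carrier F"
  show "f \<otimes>\<^bsub>F\<^esub> g \<in> carrier F" by (rule free_assoc_mult_closed[OF f g])
  fix h assume h: "h \<in> carrier F"
  note v = free_assoc_value[OF f] free_assoc_value[OF g] free_assoc_value[OF h]
  show "(f \<oplus>\<^bsub>F\<^esub> g) \<otimes>\<^bsub>F\<^esub> h = f \<otimes>\<^bsub>F\<^esub> h \<oplus>\<^bsub>F\<^esub> g \<otimes>\<^bsub>F\<^esub> h"
    by (rule ext, unfold free_assoc_simps(2,5), subst K.finsum_addf[symmetric])
      (auto simp: v K.l_distr)
  show "h \<otimes>\<^bsub>F\<^esub> (f \<oplus>\<^bsub>F\<^esub> g) = h \<otimes>\<^bsub>F\<^esub> f \<oplus>\<^bsub>F\<^esub> h \<otimes>\<^bsub>F\<^esub> g"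
    by (rule ext, unfold free_assoc_simps(2,5), subst K.finsum_addf[symmetric])
      (auto simp: v K.r_distr)
next
  fix c f g assume c: "c \<in> carrier K" and f: "f \<in> carrier F" and g: "g \<in> carrier F"
  note v = free_assoc_value[OF f] free_assoc_value[OF g]
  show "(c \<odot>\<^bsub>F\<^esub> f) \<otimes>\<^bsub>F\<^esub> g = c \<odot>\<^bsub>F\<^esub> (f \<otimes>\<^bsub>F\<^esub> g)"
    by (rule ext, unfold free_assoc_simps(3,5), subst K.finsum_rdistr)
      (auto simp: v c K.m_assoc)
  show "f \<otimes>\<^bsub>F\<^esub> (c \<odot>\<^bsub>F\<^esub> g) = c \<odot>\<^bsub>F\<^esub> (f \<otimes>\<^bsub>F\<^esub> g)"
    by (rule ext, unfold free_assoc_simps(3,5), subst K.finsum_rdistr)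
      (auto simp: v c K.m_lcomm)
qed

lemma free_assoc_mult_delta: "delta K u \<otimes>\<^bsub>F\<^esub> delta K v = delta K (u @ v)"
proof
  fix w
  have "(delta K u \<otimes>\<^bsub>F\<^esub> delta K v) w =
      (\<Oplus>\<^bsub>K\<^esub> i \<in> {..length w}. if take i w = u \<and> drop i w = v then \<one>\<^bsub>K\<^esub> else \<zero>\<^bsub>K\<^esub>)"
    unfolding free_assoc_simps(5) by (rule K.finsum_cong') (auto simp: delta_def)
  also have "\<dots> = delta K (u @ v) w"
  proof (cases "w = u @ v")
    case True
    \<comment> \<open>The sum has a single nonzero term, at the cut right after
      \<open>u\<close>.\<close>
    have "take i w = u \<and> drop i w = v \<longleftrightarrow> length u = i" if "i \<le> length w" for i
    proof
      assume "take i w = u \<and> drop i w = v"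
      then have "length (take i w) = length u" by simp
      with that show "length u = i" by (auto split: if_splits)
    qed (use True in auto)
    then have "(\<Oplus>\<^bsub>K\<^esub> i \<in> {..length w}. if take i w = u \<and> drop i w = v then \<one>\<^bsub>K\<^esub> else \<zero>\<^bsub>K\<^esub>) =
        (\<Oplus>\<^bsub>K\<^esub> i \<in> {..length w}. if length u = i then \<one>\<^bsub>K\<^esub> else \<zero>\<^bsub>K\<^esub>)"
      by (intro K.finsum_cong') auto
    also have "\<dots> = \<one>\<^bsub>K\<^esub>"
      by (rule K.finsum_singleton[where f = "\<lambda>_. \<one>\<^bsub>K\<^esub>"]) (auto simp: True)
    finally show ?thesis by (simp add: True delta_def)
  next
    case False
    then have "\<not> (take i w = u \<and> drop i w = v)" for i
      by (metis append_take_drop_id)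
    then have "(\<Oplus>\<^bsub>K\<^esub> i \<in> {..length w}. if take i w = u \<and> drop i w = v then \<one>\<^bsub>K\<^esub> else \<zero>\<^bsub>K\<^esub>) = \<zero>\<^bsub>K\<^esub>"
      by (intro K.add.finprod_one_eqI if_not_P)
    with False show ?thesis
      by (simp add: delta_def)
  qed
  finally show "(delta K u \<otimes>\<^bsub>F\<^esub> delta K v) w = delta K (u @ v) w" .
qed

section \<open>The Perm ideal and coefficients modulo it\<close>

private abbreviation (input) "perm_relations I \<equiv>
  (\<forall>x \<in> carrier F. \<forall>y \<in> carrier F. \<forall>z \<in> carrier F.
    (x \<otimes>\<^bsub>F\<^esub> (y \<otimes>\<^bsub>F\<^esub> z)) \<ominus>\<^bsub>F\<^esub> (x \<otimes>\<^bsub>F\<^esub> (z \<otimes>\<^bsub>F\<^esub> y)) \<in> I)"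

text \<open>In a word \<open>x y\<^sup>m\<close> or \<open>y\<^sup>m\<close> all letters but the first are equal, so the Perm relations, which
  permute the letters after the first, do not see its coefficient.\<close>

definition power_null :: "'x \<Rightarrow> 'x \<Rightarrow> ('x list \<Rightarrow> 'k) set" where
  "power_null x y =
    {f \<in> carrier F. \<forall>m. f (replicate m y) = \<zero>\<^bsub>K\<^esub> \<and> f (x # replicate m y) = \<zero>\<^bsub>K\<^esub>}"

text \<open>Every prefix and every suffix of \<open>x y^m\<close> or \<open>y^m\<close> is again of
  one of these forms, the empty word being \<open>y^0\<close>. So in each cut the factor taken from
  \<open>power_null\<close> vanishes.\<close>

lemma algebra_ideal_power_null: "algebra_ideal K F (power_null x y)"
  unfolding algebra_ideal_def
proof (intro conjI ballI)
  \<comment> \<open>Negation in \<open>F\<close> comes from its additive group; writing it as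
    scaling by \<open>-1\<close> gives its values pointwise.\<close>
  have neg: "(\<ominus>\<^bsub>F\<^esub> f) w = \<ominus>\<^bsub>K\<^esub> f w" if f: "f \<in> carrier F" for f w
  proof -
    have "\<ominus>\<^bsub>F\<^esub> f = (\<ominus>\<^bsub>K\<^esub> \<one>\<^bsub>K\<^esub>) \<odot>\<^bsub>F\<^esub> f"
      using f by (simp add: F.smult_l_minus)
    then show ?thesis
      using free_assoc_value[OF f, of w] by (simp add: free_assoc_simps(3) K.l_minus)
  qed
  show "submodule (power_null x y) K F"
  proof (rule F.submoduleI)
    show "\<zero>\<^bsub>F\<^esub> \<in> power_null x y"
      using F.M.zero_closed by (simp add: power_null_def free_assoc_simps(4))
  next
    fix f g assume "f \<in> power_null x y" "g \<in> power_null x y"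
    then show "f \<oplus>\<^bsub>F\<^esub> g \<in> power_null x y"
      using F.M.a_closed[of f g] by (simp add: power_null_def free_assoc_simps(2))
  next
    fix c f assume "c \<in> carrier K" "f \<in> power_null x y"
    then show "c \<odot>\<^bsub>F\<^esub> f \<in> power_null x y"
      using F.smult_closed[of c f] by (simp add: power_null_def free_assoc_simps(3))
  qed (auto simp: power_null_def neg)
next
  fix a f assume a: "a \<in> carrier F" and f: "f \<in> power_null x y"
  then have f': "f \<in> carrier F" "\<And>m. f (replicate m y) = \<zero>\<^bsub>K\<^esub>" "\<And>m. f (x # replicate m y) = \<zero>\<^bsub>K\<^esub>"
    by (simp_all add: power_null_def)
  have "(a \<otimes>\<^bsub>F\<^esub> f) (replicate m y) = \<zero>\<^bsub>K\<^esub>" "(f \<otimes>\<^bsub>F\<^esub> a) (replicate m y) = \<zero>\<^bsub>K\<^esub>" for m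
    by (rule free_assoc_mult_eq_zero, use a f' in simp_all)+
  moreover have "(a \<otimes>\<^bsub>F\<^esub> f) (x # replicate m y) = \<zero>\<^bsub>K\<^esub>" "(f \<otimes>\<^bsub>F\<^esub> a) (x # replicate m y) = \<zero>\<^bsub>K\<^esub>" for m
  proof -
    \<comment> \<open>A cut at \<open>0\<close> leaves the whole word or the empty one; a later cut
      leaves a suffix \<open>y^k\<close> and a prefix \<open>x y^k\<close>.\<close>
    have "f (drop i (x # replicate m y)) = \<zero>\<^bsub>K\<^esub>" "f (take i (x # replicate m y)) = \<zero>\<^bsub>K\<^esub>" for i
      using f' free_assoc_Nil[of f] by (cases i; simp)+
    then show "(a \<otimes>\<^bsub>F\<^esub> f) (x # replicate m y) = \<zero>\<^bsub>K\<^esub>" "(f \<otimes>\<^bsub>F\<^esub> a) (x # replicate m y) = \<zero>\<^bsub>K\<^esub>"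
      by (intro free_assoc_mult_eq_zero a f'(1); simp)+
  qed
  ultimately show "a \<otimes>\<^bsub>F\<^esub> f \<in> power_null x y" "f \<otimes>\<^bsub>F\<^esub> a \<in> power_null x y"
    using free_assoc_mult_closed a f' by (simp_all add: power_null_def)
qed

text \<open>The cut after \<open>i\<close> letters for one order of the factors matches the cut
  after \<open>m - i\<close> letters for the other, as both pieces are powers of the same
  letter.\<close>

lemma free_assoc_mult_replicate_commute:
  assumes g: "g \<in> carrier F" and h: "h \<in> carrier F"
  shows "(g \<otimes>\<^bsub>F\<^esub> h) (replicate m y) = (h \<otimes>\<^bsub>F\<^esub> g) (replicate m y)"
proof -
  note v = free_assoc_value[OF g] free_assoc_value[OF h]
  have "(g \<otimes>\<^bsub>F\<^esub> h) (replicate m y) =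
      (\<Oplus>\<^bsub>K\<^esub> i \<in> {..m}. g (replicate i y) \<otimes>\<^bsub>K\<^esub> h (replicate (m - i) y))"
    unfolding free_assoc_simps(5) by (rule K.finsum_cong') (auto simp: v min_def)
  also have "\<dots> = (\<Oplus>\<^bsub>K\<^esub> i \<in> (\<lambda>i. m - i) ` {..m}. g (replicate i y) \<otimes>\<^bsub>K\<^esub> h (replicate (m - i) y))"
  proof -
    have "(\<lambda>i. m - i) ` {..m} = {..m}"
    proof
      show "{..m} \<subseteq> (\<lambda>i. m - i) ` {..m}"
      proof
        fix i assume "i \<in> {..m}"
        then show "i \<in> (\<lambda>i. m - i) ` {..m}" by (intro image_eqI[of _ _ "m - i"]) auto
      qed
    qed auto
    then show ?thesis by simp
  qed
  also have "\<dots> = (\<Oplus>\<^bsub>K\<^esub> i \<in> {..m}. g (replicate (m - i) y) \<otimes>\<^bsub>K\<^esub> h (replicate (m - (m - i)) y))"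
    by (rule K.finsum_reindex) (auto simp: v inj_on_def)
  also have "\<dots> = (h \<otimes>\<^bsub>F\<^esub> g) (replicate m y)"
    unfolding free_assoc_simps(5) by (rule K.finsum_cong') (auto simp: v min_def K.m_comm)
  finally show ?thesis .
qed

text \<open>At cut \<open>0\<close> the factor \<open>f\<close> is evaluated at the empty word and
  gives zero. At any later cut the suffix is a power of \<open>y\<close>, on which the two orders of
  \<open>g\<close> and \<open>h\<close> agree.\<close>

lemma perm_relations_power_null: "perm_relations (power_null x y)"
proof (intro ballI)
  fix f g h assume f: "f \<in> carrier F" and g: "g \<in> carrier F" and h: "h \<in> carrier F"
  note gh = free_assoc_mult_closed[OF g h] free_assoc_mult_closed[OF h g]
  note fgh = free_assoc_mult_closed[OF f gh(1)] free_assoc_mult_closed[OF f gh(2)]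
  note v = free_assoc_value[OF f] gh[THEN free_assoc_value]
  have minus: "(p \<ominus>\<^bsub>F\<^esub> q) w = \<zero>\<^bsub>K\<^esub>" if "p \<in> carrier F" "q \<in> carrier F" "p w = q w" for p q w
  proof -
    have "p \<ominus>\<^bsub>F\<^esub> q = p \<oplus>\<^bsub>F\<^esub> (\<ominus>\<^bsub>K\<^esub> \<one>\<^bsub>K\<^esub>) \<odot>\<^bsub>F\<^esub> q"
      using that by (simp add: F.smult_l_minus a_minus_def)
    then show ?thesis
      using free_assoc_value[OF that(2), of w] that(3)
      by (simp add: free_assoc_simps(2,3) K.l_minus K.r_neg)
  qed
  have eq: "(f \<otimes>\<^bsub>F\<^esub> (g \<otimes>\<^bsub>F\<^esub> h)) w = (f \<otimes>\<^bsub>F\<^esub> (h \<otimes>\<^bsub>F\<^esub> g)) w"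
    if w: "w = replicate m y \<or> w = x # replicate m y" for w m
    unfolding free_assoc_simps(5)[of f]
  proof (rule K.finsum_cong'[OF refl])
    fix i
    show "f (take i w) \<otimes>\<^bsub>K\<^esub> (g \<otimes>\<^bsub>F\<^esub> h) (drop i w) = f (take i w) \<otimes>\<^bsub>K\<^esub> (h \<otimes>\<^bsub>F\<^esub> g) (drop i w)"
    proof (cases i)
      case 0
      then show ?thesis using v free_assoc_Nil[OF f] by simp
    next
      case (Suc j)
      with w obtain k where "drop i w = replicate k y" by auto
      then show ?thesis by (simp add: free_assoc_mult_replicate_commute[OF g h])
    qed
  qed (simp add: v)
  show "(f \<otimes>\<^bsub>F\<^esub> (g \<otimes>\<^bsub>F\<^esub> h)) \<ominus>\<^bsub>F\<^esub> (f \<otimes>\<^bsub>F\<^esub> (h \<otimes>\<^bsub>F\<^esub> g)) \<in> power_null x y"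
    unfolding power_null_def using F.M.minus_closed[OF fgh] minus[OF fgh eq] by blast
qed

lemma perm_ideal_subset_power_null: "perm_ideal K X \<subseteq> power_null x y"
  unfolding perm_ideal_def Let_def
  using algebra_ideal_power_null perm_relations_power_null by blast

lemma algebra_ideal_perm_ideal: "algebra_ideal K F (perm_ideal K X)"
proof -
  let ?S = "{I. algebra_ideal K F I \<and> perm_relations I}"
  have S: "perm_ideal K X = \<Inter> ?S"
    by (simp add: perm_ideal_def Let_def)
  \<comment> \<open>The letters are arbitrary: this only shows that the family of ideals is
    nonempty.\<close>
  have "power_null undefined undefined \<in> ?S"
    using algebra_ideal_power_null perm_relations_power_null by simp
  then have "submodule (\<Inter> ?S) K F"
    by (intro submodule_Inter[OF module_free_assoc]) (auto simp: algebra_ideal_def)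
  moreover have "a \<otimes>\<^bsub>F\<^esub> f \<in> \<Inter> ?S \<and> f \<otimes>\<^bsub>F\<^esub> a \<in> \<Inter> ?S" if "a \<in> carrier F" "f \<in> \<Inter> ?S" for a f
  proof -
    have "a \<otimes>\<^bsub>F\<^esub> f \<in> I \<and> f \<otimes>\<^bsub>F\<^esub> a \<in> I" if "I \<in> ?S" for I
      using \<open>f \<in> \<Inter> ?S\<close> that \<open>a \<in> carrier F\<close> unfolding algebra_ideal_def by blast
    then show ?thesis by blast
  qed
  ultimately show ?thesis
    unfolding S algebra_ideal_def by simp
qed

lemma submodule_perm_ideal: "submodule (perm_ideal K X) K F"
  using algebra_ideal_perm_ideal by (simp add: algebra_ideal_def)

private abbreviation (input) coset :: "('x list \<Rightarrow> 'k) \<Rightarrow> ('x list \<Rightarrow> 'k) set" where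
  "coset f \<equiv> perm_ideal K X +>\<^bsub>F\<^esub> f"

text \<open>The product of cosets is a union over representatives \<open>a\<close> and
  \<open>b\<close>. All of them give the same coset, because
  \<open>a b - f g = a (b - g) + (a - f) g\<close> lies in the ideal.\<close>

lemma Perm_mult:
  assumes f: "f \<in> carrier F" and g: "g \<in> carrier F"
  shows "coset f \<otimes>\<^bsub>Perm K X\<^esub> coset g = coset (f \<otimes>\<^bsub>F\<^esub> g)"
proof -
  let ?I = "perm_ideal K X"
  note sub = submodule_perm_ideal
  note eq_iff = coset_eq_iff[OF module_free_assoc sub]
  have I: "a \<otimes>\<^bsub>F\<^esub> x \<in> ?I" "x \<otimes>\<^bsub>F\<^esub> a \<in> ?I" if "a \<in> carrier F" "x \<in> ?I" for a x
    using algebra_ideal_perm_ideal that by (simp_all add: algebra_ideal_def)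
  have "coset (a \<otimes>\<^bsub>F\<^esub> b) = coset (f \<otimes>\<^bsub>F\<^esub> g)" if ab: "a \<in> coset f" "b \<in> coset g" for a b
  proof -
    note a = coset_memD[OF module_free_assoc sub f ab(1)]
    note b = coset_memD[OF module_free_assoc sub g ab(2)]
    have l: "linear_map K F F (\<lambda>b. a \<otimes>\<^bsub>F\<^esub> b)" and r: "linear_map K F F (\<lambda>a. a \<otimes>\<^bsub>F\<^esub> g)"
      using bilinear_map_free_assoc a(1) g by (simp_all add: bilinear_map_iff)
    have "a \<otimes>\<^bsub>F\<^esub> b \<ominus>\<^bsub>F\<^esub> a \<otimes>\<^bsub>F\<^esub> g \<in> ?I"
      using I(1)[OF a(1), of "b \<ominus>\<^bsub>F\<^esub> g"] b g
      by (simp add: eq_iff linear_map_minus[OF module_free_assoc module_free_assoc l])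
    moreover have "a \<otimes>\<^bsub>F\<^esub> g \<ominus>\<^bsub>F\<^esub> f \<otimes>\<^bsub>F\<^esub> g \<in> ?I"
      using I(2)[OF g, of "a \<ominus>\<^bsub>F\<^esub> f"] a f
      by (simp add: eq_iff linear_map_minus[OF module_free_assoc module_free_assoc r])
    ultimately show ?thesis
      using a b f g by (metis eq_iff free_assoc_mult_closed)
  qed
  then have "(\<Union>a \<in> coset f. \<Union>b \<in> coset g. coset (a \<otimes>\<^bsub>F\<^esub> b)) =
      (\<Union>a \<in> coset f. \<Union>b \<in> coset g. coset (f \<otimes>\<^bsub>F\<^esub> g))"
    by (intro SUP_cong refl)
  also have "\<dots> = coset (f \<otimes>\<^bsub>F\<^esub> g)"
    using coset_self[OF module_free_assoc sub f] coset_self[OF module_free_assoc sub g] by blast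
  finally show ?thesis
    by (simp add: Perm_def quotient_module_def rcoset_mult_def)
qed

text \<open>\<open>e\<close> chooses preimages of the generators under \<open>\<phi>\<close>, and
  \<open>coeff\<close> is the coefficient at one word on the quotient, composed with
  \<open>\<phi>\<close>. Left-nested products of values of \<open>e\<close> then stand for
  words.\<close>

lemma Perm_coefficient:
  fixes A :: "('k, 'a) module"
  assumes A: "nonassoc_algebra K A" and \<phi>: "algebra_iso K A (Perm K X) \<phi>"
  shows "\<exists>e coeff. e \<in> X \<rightarrow> carrier A \<and> linear_map K A (ring_module K) coeff \<and>
    (\<forall>w. w \<noteq> [] \<and> set w \<subseteq> X \<longrightarrow>
      coeff (list_product A (map e w)) = (if w = x # replicate m y then \<one>\<^bsub>K\<^esub> else \<zero>\<^bsub>K\<^esub>))"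
proof -
  let ?w = "x # replicate m y"
  note sub = submodule_perm_ideal
  have "linear_map K F (ring_module K) (\<lambda>f. f ?w)"
    by (rule linear_mapI) (auto simp: ring_module_def free_assoc_value free_assoc_simps(2,3))
  moreover have "f ?w = \<zero>\<^bsub>ring_module K\<^esub>" if "f \<in> perm_ideal K X" for f
    using subsetD[OF perm_ideal_subset_power_null that, of x y] by (simp add: power_null_def ring_module_def)
  ultimately obtain c where c: "linear_map K (Perm K X) (ring_module K) c"
    and c_coset: "\<And>f. f \<in> carrier F \<Longrightarrow> c (coset f) = f ?w"
    using linear_map_factor[OF module_free_assoc sub module_ring_module[OF K], of "\<lambda>f. f ?w"]
    unfolding Perm_def by metis
  have lin: "linear_map K A (Perm K X) \<phi>"
    using \<phi> by (auto simp: algebra_iso_def linear_map_def bij_betw_def)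
  have mult: "\<phi> (a \<otimes>\<^bsub>A\<^esub> b) = \<phi> a \<otimes>\<^bsub>Perm K X\<^esub> \<phi> b" if "a \<in> carrier A" "b \<in> carrier A" for a b
    using \<phi> that by (simp add: algebra_iso_def)
  have A_mult: "a \<otimes>\<^bsub>A\<^esub> b \<in> carrier A" if "a \<in> carrier A" "b \<in> carrier A" for a b
    using A that by (simp add: nonassoc_algebra_def bilinear_map_def)
  have delta: "delta K w \<in> carrier F" if "w \<in> words" for w
    using delta_closed[OF K that] by (simp add: free_assoc_simps(1))
  have "\<exists>a \<in> carrier A. \<phi> a = coset (delta K [z])" if "z \<in> X" for z
  proof -
    have "coset (delta K [z]) \<in> carrier (Perm K X)"
      using delta[of "[z]"] that quotient_module_carrier[OF module_free_assoc sub]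
      by (simp add: Perm_def)
    moreover have "\<phi> ` carrier A = carrier (Perm K X)"
      using \<phi> by (simp add: algebra_iso_def bij_betw_def)
    ultimately show ?thesis by (metis imageE)
  qed
  then obtain e where e: "\<And>z. z \<in> X \<Longrightarrow> e z \<in> carrier A"
    and \<phi>_e: "\<And>z. z \<in> X \<Longrightarrow> \<phi> (e z) = coset (delta K [z])"
    by metis
  \<comment> \<open>The word \<open>u\<close> read so far is generalised together with the
    accumulator, since both grow at each step.\<close>
  have foldl: "foldl (mult A) a (map e w) \<in> carrier A \<and> \<phi> (foldl (mult A) a (map e w)) = coset (delta K (u @ w))"
    if "a \<in> carrier A" "\<phi> a = coset (delta K u)" "u \<in> words" "set w \<subseteq> X" for a u w
    using that
  proof (induct w arbitrary: a u)
    case (Cons z w)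
    then have z: "z \<in> X" by simp
    have "\<phi> (a \<otimes>\<^bsub>A\<^esub> e z) = coset (delta K (u @ [z]))"
      using Cons.prems z delta[of u] delta[of "[z]"]
      by (simp add: mult e \<phi>_e Perm_mult free_assoc_mult_delta)
    moreover have "a \<otimes>\<^bsub>A\<^esub> e z \<in> carrier A" "u @ [z] \<in> words" "set w \<subseteq> X"
      using Cons.prems z e A_mult by auto
    ultimately show ?case
      using Cons.hyps[of "a \<otimes>\<^bsub>A\<^esub> e z" "u @ [z]"] by simp
  qed simp
  have "c (\<phi> (list_product A (map e w))) = (if w = ?w then \<one>\<^bsub>K\<^esub> else \<zero>\<^bsub>K\<^esub>)"
    if w: "w \<noteq> [] \<and> set w \<subseteq> X" for w
  proof -
    obtain z v where zv: "w = z # v" using w by (cases w) auto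
    with w have "\<phi> (list_product A (map e w)) = coset (delta K w)"
      using foldl[of "e z" "[z]" v] e \<phi>_e by (simp add: list_product_def)
    with w delta[of w] show ?thesis
      by (auto simp: c_coset delta_def)
  qed
  with e linear_map_compose[OF lin c] show ?thesis
    by (intro exI[of _ e] exI[of _ "\<lambda>a. c (\<phi> a)"]) auto
qed

end

subsection \<open>Injectivity of \<open>\<Psi>\<close>\<close>

lemma contraction_Psi_value:
  fixes K :: "('k, 'e) ring_scheme" and A :: "('k, 'a) module" and N :: "('k, 'n) module"
  assumes A: "nonassoc_algebra K A" and P: "module K P" and N: "module K N" and n: "n \<ge> 1"
    and f: "f \<in> C_Pre K P N n"
    and e: "e \<in> X \<rightarrow> carrier A" and xy: "x \<in> X" "y \<in> X" "x \<noteq> y"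
    and coeff: "linear_map K A (ring_module K) coeff"
    and coeff_e: "\<And>w. w \<noteq> [] \<Longrightarrow> set w \<subseteq> X \<Longrightarrow> coeff (list_product A (map e w)) =
      (if w = x # replicate (n - 1) y then \<one>\<^bsub>K\<^esub> else \<zero>\<^bsub>K\<^esub>)"
    and h: "linear_map K (tensor_product K A N) N h"
    and h_pt: "\<And>a m. a \<in> carrier A \<Longrightarrow> m \<in> carrier N \<Longrightarrow> h (pure_tensor K A N a m) = coeff a \<odot>\<^bsub>N\<^esub> m"
    and bs: "length bs = n" "set bs \<subseteq> carrier P"
  shows "h (Psi_value K A P N n f (map e (x # replicate (n - 1) y)) bs) = f bs"
proof -
  have A': "module K A" using A by (simp add: nonassoc_algebra_def)
  let ?w = "x # replicate (n - 1) y"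
  let ?T = "tensor_product K A N"
  interpret N: module K N by (rule N)
  interpret T: module K ?T by (rule module_tensor_product[OF A' N])
  \<comment> \<open>Terms are indexed by words in \<open>x\<close> and \<open>y\<close> rather than
    by elements of \<open>A\<close>, so that the word alone decides whether \<open>h\<close> keeps
    or kills a term.\<close>
  define tm where "tm w bs' = pure_tensor K A N (list_product A (map e w)) (f bs')" for w bs'
  have f': "multilinear_on K n P N f"
    using f by (simp add: C_Pre_def multilinear_maps_iff)
  have tm: "tm w bs' \<in> carrier ?T"
    and h_tm: "h (tm w bs') = (if w = ?w then f bs' else \<zero>\<^bsub>N\<^esub>)"
    if w: "length w = n" "set w \<subseteq> {x, y}" and bs': "length bs' = n" "set bs' \<subseteq> carrier P" for w bs'
  proof -
    have wX: "set w \<subseteq> X" "w \<noteq> []" using w xy n by auto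
    have "set (map e w) \<subseteq> carrier A" using wX e by auto
    then have a: "list_product A (map e w) \<in> carrier A"
      using multilinear_onD(1)[OF multilinear_on_list_product[OF A n], of "map e w"] w by simp
    have b: "f bs' \<in> carrier N" by (rule multilinear_onD(1)[OF f' bs'])
    show "tm w bs' \<in> carrier ?T"
      using bilinear_map_pure_tensor[OF A' N] a b by (simp add: tm_def bilinear_map_def)
    show "h (tm w bs') = (if w = ?w then f bs' else \<zero>\<^bsub>N\<^esub>)"
      using a b wX by (simp add: tm_def h_pt coeff_e)
  qed
  have w: "length ?w = n" "set ?w \<subseteq> {x, y}" using n by auto
  have nth_w: "?w ! i = y" if "0 < i" "i < n" for i
    using that by (cases i) auto
  have first: "tm ?w bs \<in> carrier ?T" "h (tm ?w bs) = f bs"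
    using tm[OF w bs] h_tm[OF w bs] by simp_all
  have other: "tm v bs' \<in> carrier ?T" "h (tm v bs') = \<zero>\<^bsub>N\<^esub>"
    if v: "length v = n" "set v \<subseteq> {x, y}" "v ! 0 = y" and bs': "length bs' = n" "set bs' \<subseteq> carrier P" for v bs'
  proof -
    have "v \<noteq> ?w" using v(3) xy(3) by (metis nth_Cons_0)
    then show "tm v bs' \<in> carrier ?T" "h (tm v bs') = \<zero>\<^bsub>N\<^esub>"
      using tm[OF v(1,2) bs'] h_tm[OF v(1,2) bs'] by simp_all
  qed
  let ?w2 = "?w[0 := ?w ! 1, 1 := ?w ! 0]" and ?bs2 = "bs[0 := bs ! 1, 1 := bs ! 0]"
  have map_w2: "(map e ?w)[0 := map e ?w ! 1, 1 := map e ?w ! 0] = map e ?w2" if "n > 1"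
    using that by (simp add: map_update)
  have second: "tm ?w2 ?bs2 \<in> carrier ?T" "h (tm ?w2 ?bs2) = \<zero>\<^bsub>N\<^esub>" if "n > 1"
  proof -
    have "set ?w2 \<subseteq> set ?w" "set ?bs2 \<subseteq> set bs"
      using that w(1) bs(1) rearrangement_swap[of 0 n]
      unfolding rearrangement_def One_nat_def by blast+
    then have "set ?w2 \<subseteq> {x, y}" "set ?bs2 \<subseteq> carrier P"
      using w(2) bs(2) by (meson subset_trans)+
    then show "tm ?w2 ?bs2 \<in> carrier ?T" "h (tm ?w2 ?bs2) = \<zero>\<^bsub>N\<^esub>"
      using other[of ?w2 ?bs2] that w bs nth_w[of 1] by simp_all
  qed
  let ?wm = "\<lambda>i. rev (take (i + 1) ?w) @ drop (i + 1) ?w"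
  let ?bsm = "\<lambda>i. take (i - 1) bs @ [bs ! i, bs ! (i - 1)] @ drop (i + 1) bs"
  have middle: "tm (?wm i) (?bsm i) \<in> carrier ?T" "h (tm (?wm i) (?bsm i)) = \<zero>\<^bsub>N\<^esub>"
    if i: "i \<in> {2..n - 2}" for i
  proof -
    have i': "0 < i" "i < n" using i by auto
    have 1: "length (?wm i) = n" using i' w by simp
    have 2: "set (?wm i) \<subseteq> {x, y}"
      using w(2) set_take_subset[of "i + 1" ?w] set_drop_subset[of "i + 1" ?w] by auto
    \<comment> \<open>Reversing \<open>i + 1\<close> letters brings position \<open>i\<close> to the
      front, and \<open>x\<close> sits only at position \<open>0\<close>.\<close>
    have 3: "?wm i ! 0 = y"
      using i' w nth_w[OF i'] by (simp add: nth_append rev_nth del: replicate.simps take_Suc_Cons drop_Suc_Cons)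
    have 4: "length (?bsm i) = n" using i' bs by simp
    have 5: "set (?bsm i) \<subseteq> carrier P"
      using i' bs set_take_subset[of "i - 1" bs] set_drop_subset[of "i + 1" bs] by auto
    show "tm (?wm i) (?bsm i) \<in> carrier ?T" "h (tm (?wm i) (?bsm i)) = \<zero>\<^bsub>N\<^esub>"
      by (rule other[OF 1 2 3 4 5])+
  qed
  \<comment> \<open>For \<open>n = 1\<close> reversal leaves the word unchanged, hence the condition
    \<open>n > 1\<close>.\<close>
  have last: "tm (rev ?w) (rev bs) \<in> carrier ?T" "h (tm (rev ?w) (rev bs)) = \<zero>\<^bsub>N\<^esub>" if "n > 1"
  proof -
    have "rev ?w ! 0 = y"
      using that w nth_w[of "n - 1"] by (subst rev_nth) simp_all
    then show "tm (rev ?w) (rev bs) \<in> carrier ?T" "h (tm (rev ?w) (rev bs)) = \<zero>\<^bsub>N\<^esub>"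
      using that w bs by (intro other; simp)+
  qed
  have sign: "(\<ominus>\<^bsub>K\<^esub> \<one>\<^bsub>K\<^esub>) [^]\<^bsub>K\<^esub> i \<in> carrier K" for i :: nat
    by (intro N.R.nat_pow_closed) simp
  have h_minus: "h (p \<ominus>\<^bsub>?T\<^esub> q) = h p"
    if "p \<in> carrier ?T" "q \<in> carrier ?T" "h q = \<zero>\<^bsub>N\<^esub>" for p q
    unfolding linear_map_minus[OF T.module_axioms N h that(1,2)] that(3)
    using linear_map_closed[OF h that(1)] by (simp add: a_minus_def)
  have fbs: "f bs \<in> carrier N" by (rule multilinear_onD(1)[OF f' bs])
  consider "n = 1" | "n = 2" | "n > 2"
    using n by linarith
  then show ?thesis
  proof cases
    case 1
    with first show ?thesis by (simp add: Psi_value_def tm_def)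
  next
    case 2
    have "Psi_value K A P N n f (map e ?w) bs = tm ?w bs \<ominus>\<^bsub>?T\<^esub> tm ?w2 ?bs2"
      unfolding Psi_value_def Let_def tm_def using 2 map_w2 by simp
    with 2 first second fbs show ?thesis
      by (simp add: h_minus)
  next
    case 3
    define S where "S = (\<Oplus>\<^bsub>?T\<^esub> i \<in> {2..n - 2}. (\<ominus>\<^bsub>K\<^esub> \<one>\<^bsub>K\<^esub>) [^]\<^bsub>K\<^esub> i \<odot>\<^bsub>?T\<^esub> tm (?wm i) (?bsm i))"
    have S: "S \<in> carrier ?T"
      unfolding S_def using middle(1) sign by (intro T.M.finsum_closed) blast
    have "h S = (\<Oplus>\<^bsub>N\<^esub> i \<in> {2..n - 2}. h ((\<ominus>\<^bsub>K\<^esub> \<one>\<^bsub>K\<^esub>) [^]\<^bsub>K\<^esub> i \<odot>\<^bsub>?T\<^esub> tm (?wm i) (?bsm i)))"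
      unfolding S_def using middle(1) sign
      by (intro linear_map_finsum[OF T.module_axioms N h]) blast+
    also have "\<dots> = \<zero>\<^bsub>N\<^esub>"
      by (rule N.M.add.finprod_one_eqI)
        (simp only: linear_map_smult[OF h sign middle(1)] middle(2) N.smult_r_null[OF sign])
    finally have hS: "h S = \<zero>\<^bsub>N\<^esub>" .
    define R where "R = (\<ominus>\<^bsub>K\<^esub> \<one>\<^bsub>K\<^esub>) [^]\<^bsub>K\<^esub> (n - 1) \<odot>\<^bsub>?T\<^esub> tm (rev ?w) (rev bs)"
    have R: "R \<in> carrier ?T" "h R = \<zero>\<^bsub>N\<^esub>"
      unfolding R_def using 3 last sign by (simp_all add: linear_map_smult[OF h])
    define Q where "Q = tm ?w2 ?bs2"
    have Q: "Q \<in> carrier ?T" "h Q = \<zero>\<^bsub>N\<^esub>"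
      unfolding Q_def using 3 second by simp_all
    have "Psi_value K A P N n f (map e ?w) bs = ((tm ?w bs \<ominus>\<^bsub>?T\<^esub> Q) \<oplus>\<^bsub>?T\<^esub> S) \<oplus>\<^bsub>?T\<^esub> R"
      unfolding Psi_value_def Let_def S_def R_def Q_def tm_def
      using 3 map_w2 by (simp only: rev_map take_map drop_map map_append if_False) simp
    with first Q S hS R fbs show ?thesis
      by (simp add: h_minus linear_map_add[OF h])
  qed
qed

theorem mainTheorem5:
  fixes K :: "('k, 'e) ring_scheme"
    and A :: "('k, 'a) module"
    and P :: "('k, 'p) module"
    and N :: "('k, 'n) module"
    and l :: "'p \<Rightarrow> 'n \<Rightarrow> 'n"
    and r :: "'n \<Rightarrow> 'p \<Rightarrow> 'n"
    and X :: "'x set"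
  assumes "field K"
    and "nonassoc_algebra K A"
    and "\<exists>x \<in> X. \<exists>y \<in> X. x \<noteq> y"
    and "\<exists>\<phi>. algebra_iso K A (Perm K X) \<phi>"
    and "pre_lie_algebra K P"
    and "pre_lie_bimodule K P N l r"
  shows "\<forall>n \<ge> 1.
    Psi K A P N n \<in> C_Pre K P N n \<rightarrow>
      multilinear_maps K n (tensor_product K A P) (tensor_product K A N) \<and>
    inj_on (Psi K A P N n) (C_Pre K P N n)"
proof (intro allI impI conjI)
  note A = assms(2)
  have A': "module K A" using A by (simp add: nonassoc_algebra_def)
  have P: "module K P" using assms(5) by (simp add: pre_lie_algebra_def nonassoc_algebra_def)
  have N: "module K N" using assms(6) by (simp add: pre_lie_bimodule_def)
  interpret N: module K N by (rule N)
  have K: "cring K" by (rule N.R.is_cring)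
  obtain x y where xy: "x \<in> X" "y \<in> X" "x \<noteq> y" using assms(3) by blast
  obtain \<phi> where \<phi>: "algebra_iso K A (Perm K X) \<phi>" using assms(4) by blast
  fix n :: nat assume n: "n \<ge> 1"
  note spec = Psi_spec[OF A P N n]
  show "Psi K A P N n \<in> C_Pre K P N n \<rightarrow>
      multilinear_maps K n (tensor_product K A P) (tensor_product K A N)"
    using spec by blast
  obtain e coeff where e: "e \<in> X \<rightarrow> carrier A" and coeff: "linear_map K A (ring_module K) coeff"
    and coeff_e: "\<forall>w. w \<noteq> [] \<and> set w \<subseteq> X \<longrightarrow>
      coeff (list_product A (map e w)) = (if w = x # replicate (n - 1) y then \<one>\<^bsub>K\<^esub> else \<zero>\<^bsub>K\<^esub>)"
    using Perm_coefficient[OF K A \<phi>, of x "n - 1" y] by blast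
  have "bilinear_map K A N N (\<lambda>a m. coeff a \<odot>\<^bsub>N\<^esub> m)"
    using coeff unfolding bilinear_map_def linear_map_def ring_module_def
    by (auto simp: N.smult_l_distr N.smult_r_distr N.smult_assoc1[symmetric] N.R.m_comm)
  then obtain h where h: "linear_map K (tensor_product K A N) N h"
    and h_pt: "\<forall>a \<in> carrier A. \<forall>m \<in> carrier N. h (pure_tensor K A N a m) = coeff a \<odot>\<^bsub>N\<^esub> m"
    using tensor_product_lift[OF A' N N] by blast
  show "inj_on (Psi K A P N n) (C_Pre K P N n)"
  proof (rule inj_onI)
    fix f g assume f: "f \<in> C_Pre K P N n" and g: "g \<in> C_Pre K P N n"
      and eq: "Psi K A P N n f = Psi K A P N n g"
    have "f bs = g bs" if bs: "length bs = n" "set bs \<subseteq> carrier P" for bs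
    proof -
      \<comment> \<open>The components in \<open>A\<close> are the same for every \<open>bs\<close>,
        so the single contraction \<open>h\<close> recovers all values of a cochain.\<close>
      let ?as = "map e (x # replicate (n - 1) y)"
      have as: "length ?as = n \<and> set ?as \<subseteq> carrier A \<and> length bs = n \<and> set bs \<subseteq> carrier P"
        using n e xy bs by auto
      have "Psi_value K A P N n f ?as bs = Psi_value K A P N n g ?as bs"
        using conjunct2[OF spec[OF f], rule_format, OF as] conjunct2[OF spec[OF g], rule_format, OF as]
        unfolding eq by (rule trans[OF sym])
      moreover have "h (Psi_value K A P N n k ?as bs) = k bs" if k: "k \<in> C_Pre K P N n" for k
        by (rule contraction_Psi_value[OF A P N n k e xy coeff _ h _ bs]) (use coeff_e h_pt in simp_all)
      ultimately show ?thesis using f g by metis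
    qed
    moreover have "f \<in> extensional {bs. length bs = n \<and> set bs \<subseteq> carrier P}"
      "g \<in> extensional {bs. length bs = n \<and> set bs \<subseteq> carrier P}"
      using f g by (simp_all add: C_Pre_def multilinear_maps_iff)
    ultimately show "f = g"
      by (intro extensionalityI[of f _ g]) auto
  qed
qed

end
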